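(* Let $\Gamma$ be a countably infinite discrete group. There exists a free $\Gamma$-flow that is $\Delta$-minimal with respect to every non-locally finite subgroup $\Delta\leq\Gamma$ (that is, a single free $\Gamma$-flow that is $\Delta$-minimal simultaneously for all subgroups $\Delta\leq\Gamma$ that are not locally finite).
   Context: A $\Gamma$-flow is a nonempty compact Hausdorff space $X$ equipped with a continuous action of $\Gamma$. It is free if $\gamma\cdot x\neq x$ for all $x\in X$ and all non-identity $\gamma\in\Gamma$. For a subset $S\subseteq\Gamma$, a $\Gamma$-flow $X$ is $S$-minimal if for every $x\in X$ the partial orbit $S\cdot x=\{\sigma\cdot x:\sigma\in S\}$ is dense in $X$. A group is locally finite if all of its finitely generated subgroups are finite. *)

theory Defs
  imports "HOL-Analysis.Analysis" "HOL-Algebra.Group_Action" "HOL-Algebra.Generated_Groups"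
begin

text \<open>
  A group \<open>G\<close> carries the discrete topology throughout. An action is the library's
  \<open>group_action\<close>: a homomorphism \<open>\<phi>\<close> from \<open>G\<close> to the group of permutations of the space.
\<close>

definition flow :: "('g, 'm) monoid_scheme \<Rightarrow> 'x topology \<Rightarrow> ('g \<Rightarrow> 'x \<Rightarrow> 'x) \<Rightarrow> bool" where
  "flow G T \<phi> \<longleftrightarrow>
     topspace T \<noteq> {} \<and> compact_space T \<and> Hausdorff_space T \<and>
     group_action G (topspace T) \<phi> \<and>
     continuous_map (prod_topology (discrete_topology (carrier G)) T) T (\<lambda>(g, x). \<phi> g x)"

definition free_flow :: "('g, 'm) monoid_scheme \<Rightarrow> 'x topology \<Rightarrow> ('g \<Rightarrow> 'x \<Rightarrow> 'x) \<Rightarrow> bool" where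
  "free_flow G T \<phi> \<longleftrightarrow>
     flow G T \<phi> \<and> (\<forall>x\<in>topspace T. \<forall>g\<in>carrier G. g \<noteq> \<one>\<^bsub>G\<^esub> \<longrightarrow> \<phi> g x \<noteq> x)"

definition minimal_wrt :: "'g set \<Rightarrow> 'x topology \<Rightarrow> ('g \<Rightarrow> 'x \<Rightarrow> 'x) \<Rightarrow> bool" where
  "minimal_wrt S T \<phi> \<longleftrightarrow>
     (\<forall>x\<in>topspace T. T closure_of {\<phi> s x | s. s \<in> S} = topspace T)"

definition locally_finite_group :: "('g, 'm) monoid_scheme \<Rightarrow> bool" where
  "locally_finite_group G \<longleftrightarrow>
     (\<forall>S. finite S \<and> S \<subseteq> carrier G \<longrightarrow> finite (generate G S))"

text \<open>
  HOL cannot quantify existentially over types, so an assertion that some flow of a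
  countably infinite group \<open>G\<close> with elements in \<open>'g\<close> exists has to name a type of points.
  The type \<open>'g set set\<close> excludes no flow that matters here. It has at least \<open>2^(2^aleph_0)\<close>
  elements, and every separable Hausdorff space injects into the double power set of a
  countable dense subset. A flow minimal with respect to some subgroup of \<open>G\<close> is separable,
  and any free flow contains a separable one, namely the closure of an orbit. Each such
  flow therefore has a homeomorphic, equivariant copy with points in \<open>'g set set\<close>.
\<close>

type_synonym 'g flow_point = "'g set set"

end

theory Submission
  imports Defs
begin

text \<open>
  The flow is the orbit closure of a single colouring \<open>x\<close> of \<open>G \<times> nat\<close> with three colours, where
  \<open>G\<close> acts by \<open>(g y) (h, i) = y (h g, i)\<close>. Let \<open>\<gamma>\<close> enumerate \<open>G\<close>. If \<open>\<gamma> i \<noteq> 1\<close>, then coordinate \<open>i\<close> of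
  \<open>x\<close> is a proper colouring of the graph that joins every \<open>h\<close> to \<open>\<gamma> i h\<close>. This condition is closed and
  invariant under the action, and it forces \<open>\<gamma> i\<close> to move every point of the orbit closure.
  
  The orbit closure is minimal with respect to \<open>D\<close> if every finite pattern of \<open>x\<close> recurs along \<open>D\<close>
  with bounded gaps. A subgroup that is not locally finite contains an infinite finitely generated
  one, and a countable group has only countably many of those, so that there are countably many
  requirements. A neighbourhood of \<open>g x\<close> is the image under \<open>g\<close> of a neighbourhood of \<open>x\<close>. Hence
  all patterns are covered by those around \<open>1\<close> if these recur along all cosets \<open>g D\<close> instead of only
  along \<open>D\<close>. Let the sequence \<open>S\<close> list the cosets, each of them infinitely often.
  
  The colouring \<open>x\<close> is the union of finite patterns \<open>p 0 \<subseteq> p 1 \<subseteq> \<dots>\<close>. Level \<open>n\<close> requires a finite set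
  \<open>F \<subseteq> S n\<close> such that for every \<open>g\<close> there is a copy of \<open>p n\<close> at some point of \<open>F g\<close>. To meet it, a finite
  window \<open>K \<subseteq> S n\<close> is chosen that is huge compared with \<open>p n\<close>, and one copy of \<open>p n\<close> is placed in each
  member of a maximal disjoint family of translates \<open>K m\<close>. Every \<open>K g\<close> meets one of these, so that
  \<open>F = K K\<^sup>-\<^sup>1 K\<close> has the required property. The copies must be far from each other;
  as the windows are huge, positions with this property exist (lemma \<open>independent_transversal\<close>, a
  counting argument together with compactness).
  
  The difficulty is that the levels interfere. A copy of \<open>p n\<close> is put down first, and afterwards the
  patterns \<open>p j\<close> with \<open>j < n\<close> have to recur around it, although the space near it is blocked for them.
  Call a window heavy for a partial colouring if at least half of it is blocked, and call a partial
  colouring good if it has provided for all its heavy windows on its own. Then only light windows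
  are left, and they have enough room. The proof rests on three facts. Good colourings that are far
  apart can be combined (lemma \<open>good_Union\<close>). Every good colouring extends to one that meets the
  requirements of all lower levels on the whole group (lemma \<open>fill\<close>). From such a colouring one
  can cut out a good finite piece that contains a given finite set (lemma \<open>cut\<close>): whenever a window
  becomes heavy, its copy is added to the piece. This stops after finitely many steps, because every
  added copy is charged to half a window of blocked points, these windows are disjoint, and they
  are far larger than the copies. So \<open>p (n + 1)\<close> is obtained from \<open>p n\<close> by filling up and cutting.
\<close>

section \<open>Choosing from disjoint sets\<close>

definition independent_choices :: "('v \<Rightarrow> 'v \<Rightarrow> bool) \<Rightarrow> ('i \<Rightarrow> 'v set) \<Rightarrow> 'i set \<Rightarrow> ('i \<Rightarrow> 'v) set" where
  "independent_choices R C A =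
     {f \<in> PiE A C. \<forall>i\<in>A. \<forall>j\<in>A. i \<noteq> j \<longrightarrow> \<not> R (f i) (f j)}"

lemma independent_choices_restrict:
  assumes "f \<in> independent_choices R C A" "B \<subseteq> A"
  shows "restrict f B \<in> independent_choices R C B"
  using assms unfolding independent_choices_def by (auto simp: PiE_def Pi_def)

lemma finite_independent_choices:
  assumes "finite A" "\<And>i. i \<in> A \<Longrightarrow> finite (C i)"
  shows "finite (independent_choices R C A)"
  unfolding independent_choices_def
  by (rule finite_subset[of _ "PiE A C"]) (auto intro: finite_PiE assms)

text \<open>
  Among the extensions of the choices on \<open>A\<close> to the index \<open>i\<close>, those with a conflict are counted by
  the earlier value \<open>w\<close> that takes part in it. Since the sets are disjoint, \<open>w\<close> belongs to only one
  index, and by induction prescribing the value there divides the number of choices by at least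
  \<open>2 * d\<close>. With at most \<open>d\<close> conflicts for each value at \<open>i\<close>, at least half of the extensions survive.
  This is Rosenfeld's counting alternative to the Lovasz Local Lemma.
\<close>

lemma card_independent_choices_insert:
  fixes R :: "'v \<Rightarrow> 'v \<Rightarrow> bool" and C :: "'i \<Rightarrow> 'v set"
  assumes disj: "disjoint_family_on C J"
    and fin: "\<And>j. j \<in> J \<Longrightarrow> finite (C j)"
    and big: "\<And>j. j \<in> J \<Longrightarrow> 4 * d \<le> card (C j)"
    and sym: "\<And>v w. R v w \<Longrightarrow> R w v"
    and deg: "\<And>v. finite {w. R v w} \<and> card {w. R v w} \<le> d"
    and "d > 0" "finite A" "A \<subseteq> J" "i \<in> J" "i \<notin> A"
  shows "2 * d * card (independent_choices R C A) \<le> card (independent_choices R C (insert i A))"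
  using \<open>finite A\<close> \<open>A \<subseteq> J\<close> \<open>i \<in> J\<close> \<open>i \<notin> A\<close>
proof (induction "card A" arbitrary: A i rule: less_induct)
  case less
  let ?I = "independent_choices R C"
  have finI: "finite (?I B)" if "B \<subseteq> A" for B
    using that less.prems fin by (intro finite_independent_choices) (auto intro: finite_subset)
  \<comment> \<open>Only one index can take the value \<open>w\<close>, and deleting it loses no information.\<close>
  have fixed: "2 * d * card {f \<in> ?I A. \<exists>j\<in>A. f j = w} \<le> card (?I A)" for w
  proof (cases "\<exists>j\<in>A. w \<in> C j")
    case True
    then obtain j where j: "j \<in> A" "w \<in> C j" by blast
    have uniq: "k = j" if "f \<in> ?I A" "k \<in> A" "f k = w" for f k
    proof (rule ccontr)
      assume "k \<noteq> j"
      moreover have "w \<in> C k" using that by (auto simp: independent_choices_def PiE_def Pi_def)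
      ultimately show False using j that disj less.prems(2) unfolding disjoint_family_on_def by blast
    qed
    have "card {f \<in> ?I A. \<exists>j\<in>A. f j = w} \<le> card (?I (A - {j}))"
    proof (rule card_inj_on_le[where f = "\<lambda>f. restrict f (A - {j})"])
      show "inj_on (\<lambda>f. restrict f (A - {j})) {f \<in> ?I A. \<exists>j\<in>A. f j = w}"
      proof (rule inj_onI)
        fix f g assume f: "f \<in> {f \<in> ?I A. \<exists>j\<in>A. f j = w}" and g: "g \<in> {f \<in> ?I A. \<exists>j\<in>A. f j = w}"
          and eq: "restrict f (A - {j}) = restrict g (A - {j})"
        have "f j = w" "g j = w" using f g uniq by blast+
        moreover have "f k = g k" if "k \<in> A" "k \<noteq> j" for k
          using fun_cong[OF eq, of k] that by simp
        moreover have "f \<in> extensional A" "g \<in> extensional A"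
          using f g by (auto simp: independent_choices_def PiE_def)
        ultimately show "f = g" by (metis extensionalityI)
      qed
    qed (use independent_choices_restrict finI in \<open>fastforce+\<close>)
    moreover have "2 * d * card (?I (A - {j})) \<le> card (?I (insert j (A - {j})))"
      using less.prems j by (intro less.hyps card_Diff1_less) auto
    moreover have "insert j (A - {j}) = A" using j by blast
    ultimately show ?thesis by (metis (no_types, lifting) le_trans mult_le_mono2)
  next
    case False
    then have none: "{f \<in> ?I A. \<exists>j\<in>A. f j = w} = {}"
      by (auto simp: independent_choices_def PiE_def Pi_def)
    show ?thesis unfolding none by simp
  qed
  define X where "X = ?I A \<times> C i"
  define Bad where "Bad = {(f, v). f \<in> ?I A \<and> v \<in> C i \<and> (\<exists>j\<in>A. R v (f j))}"
  have finX: "finite X" unfolding X_def using finI[of A] fin less.prems by auto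
  have "Bad \<subseteq> (\<Union>v\<in>C i. \<Union>w\<in>{w. R v w}. {f \<in> ?I A. \<exists>j\<in>A. f j = w} \<times> {v})"
    unfolding Bad_def by blast
  then have "card Bad \<le> card (\<Union>v\<in>C i. \<Union>w\<in>{w. R v w}. {f \<in> ?I A. \<exists>j\<in>A. f j = w} \<times> {v})"
    using finI[of A] fin less.prems deg by (intro card_mono) auto
  also have "\<dots> \<le> (\<Sum>v\<in>C i. card (\<Union>w\<in>{w. R v w}. {f \<in> ?I A. \<exists>j\<in>A. f j = w} \<times> {v}))"
    using fin less.prems by (intro card_UN_le) auto
  also have "\<dots> \<le> (\<Sum>v\<in>C i. \<Sum>w\<in>{w. R v w}. card ({f \<in> ?I A. \<exists>j\<in>A. f j = w} \<times> {v}))"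
    using deg by (intro sum_mono card_UN_le) auto
  finally have "card Bad \<le> (\<Sum>v\<in>C i. \<Sum>w\<in>{w. R v w}. card {f \<in> ?I A. \<exists>j\<in>A. f j = w})"
    by (simp add: card_cartesian_product)
  then have "2 * d * card Bad \<le> 2 * d * (\<Sum>v\<in>C i. \<Sum>w\<in>{w. R v w}. card {f \<in> ?I A. \<exists>j\<in>A. f j = w})"
    by (rule mult_le_mono2)
  also have "\<dots> = (\<Sum>v\<in>C i. \<Sum>w\<in>{w. R v w}. 2 * d * card {f \<in> ?I A. \<exists>j\<in>A. f j = w})"
    by (simp add: sum_distrib_left)
  also have "\<dots> \<le> (\<Sum>v\<in>C i. \<Sum>w\<in>{w. R v w}. card (?I A))"
    by (intro sum_mono fixed)
  also have "\<dots> \<le> (\<Sum>v\<in>C i. d * card (?I A))"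
    using deg by (intro sum_mono) simp
  finally have "d * (2 * card Bad) \<le> d * (card (C i) * card (?I A))" by (simp add: algebra_simps)
  then have bad: "2 * card Bad \<le> card X"
    using \<open>d > 0\<close> by (simp add: X_def card_cartesian_product algebra_simps)
  have "card (X - Bad) \<le> card (?I (insert i A))"
  proof (rule card_inj_on_le[where f = "\<lambda>(f, v). f(i := v)"])
    show "inj_on (\<lambda>(f, v). f(i := v)) (X - Bad)"
    proof (rule inj_onI, clarify)
      fix f v g w assume fg: "(f, v) \<in> X" "(g, w) \<in> X" and eq: "f(i := v) = g(i := w)"
      have "f \<in> extensional A" "g \<in> extensional A"
        using fg by (auto simp: X_def independent_choices_def PiE_def)
      then have "f i = g i" using less.prems by (auto simp: extensional_def)
      then show "f = g \<and> v = w" using eq by (metis fun_upd_same fun_upd_triv fun_upd_upd)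
    qed
    show "(\<lambda>(f, v). f(i := v)) ` (X - Bad) \<subseteq> ?I (insert i A)"
    proof clarify
      fix f v assume fv: "(f, v) \<in> X" "(f, v) \<notin> Bad"
      then have f: "f \<in> PiE A C" "v \<in> C i" "\<And>j. j \<in> A \<Longrightarrow> \<not> R v (f j)"
        "\<And>j k. j \<in> A \<Longrightarrow> k \<in> A \<Longrightarrow> j \<noteq> k \<Longrightarrow> \<not> R (f j) (f k)"
        by (auto simp: X_def Bad_def independent_choices_def)
      then have "\<And>j. j \<in> A \<Longrightarrow> \<not> R (f j) v" using sym by blast
      with f show "f(i := v) \<in> ?I (insert i A)"
        using less.prems unfolding independent_choices_def by (auto simp: PiE_def Pi_def extensional_def)
    qed
    show "finite (?I (insert i A))"
      using less.prems fin by (intro finite_independent_choices) auto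
  qed
  moreover have "card (X - Bad) = card X - card Bad"
    using finX by (intro card_Diff_subset) (auto simp: X_def Bad_def intro: finite_subset)
  moreover have "4 * d * card (?I A) \<le> card X"
    using big less.prems by (simp add: X_def card_cartesian_product)
  ultimately show ?case using bad by linarith
qed

lemma independent_transversal_finite:
  assumes disj: "disjoint_family_on C J"
    and fin: "\<And>j. j \<in> J \<Longrightarrow> finite (C j)"
    and big: "\<And>j. j \<in> J \<Longrightarrow> 4 * d \<le> card (C j)"
    and sym: "\<And>v w. R v w \<Longrightarrow> R w v"
    and deg: "\<And>v. finite {w. R v w} \<and> card {w. R v w} \<le> d"
    and "d > 0" "finite A" "A \<subseteq> J"
  shows "independent_choices R C A \<noteq> {}"
  using \<open>finite A\<close> \<open>A \<subseteq> J\<close>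
proof (induction A rule: finite_induct)
  case empty
  then show ?case by (auto simp: independent_choices_def)
next
  case (insert i A)
  then have "card (independent_choices R C A) > 0"
    using fin by (auto simp: card_gt_0_iff intro!: finite_independent_choices)
  moreover have "2 * d * card (independent_choices R C A) \<le> card (independent_choices R C (insert i A))"
    using insert.prems insert.hyps assms by (intro card_independent_choices_insert) auto
  ultimately have "card (independent_choices R C (insert i A)) > 0"
    using \<open>d > 0\<close> by (metis less_le_trans mult_pos_pos zero_less_numeral)
  then show ?case by auto
qed

text \<open>
  The infinite case follows by compactness: the choices form a product of finite discrete spaces,
  and the absence of a conflict between two given indices is a closed condition.
\<close>

lemma independent_transversal:
  assumes disj: "disjoint_family_on C J"
    and fin: "\<And>j. j \<in> J \<Longrightarrow> finite (C j)"
    and big: "\<And>j. j \<in> J \<Longrightarrow> 4 * d \<le> card (C j)"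
    and sym: "\<And>v w. R v w \<Longrightarrow> R w v"
    and deg: "\<And>v. finite {w. R v w} \<and> card {w. R v w} \<le> d"
    and d: "d > 0"
  obtains f where "\<And>j. j \<in> J \<Longrightarrow> f j \<in> C j" "\<And>i j. i \<in> J \<Longrightarrow> j \<in> J \<Longrightarrow> i \<noteq> j \<Longrightarrow> \<not> R (f i) (f j)"
proof -
  define T where "T = product_topology (\<lambda>j. discrete_topology (C j)) J"
  define P where "P A = {f \<in> topspace T. restrict f A \<in> independent_choices R C A}" for A
  have T: "compact_space T"
    unfolding T_def compact_space_product_topology
    using fin by (auto simp: compact_space_discrete_topology)
  have closed: "closedin T (P {i, j})" if "i \<in> J" "j \<in> J" for i j
  proof -
    have cm: "continuous_map T (discrete_topology (C i \<times> C j)) (\<lambda>f. (f i, f j))"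
      unfolding T_def prod_topology_discrete_topology using that
      by (intro continuous_map_pairedI continuous_map_product_projection)
    have "P {i, j} = {f \<in> topspace T. (f i, f j) \<in> {(v, w). v \<in> C i \<and> w \<in> C j \<and> (i \<noteq> j \<longrightarrow> \<not> R v w)}}"
    proof -
      have "restrict f {i, j} \<in> independent_choices R C {i, j} \<longleftrightarrow> (i \<noteq> j \<longrightarrow> \<not> R (f i) (f j))"
        if "f \<in> topspace T" for f
      proof -
        have "f i \<in> C i" "f j \<in> C j"
          using that \<open>i \<in> J\<close> \<open>j \<in> J\<close> by (auto simp: T_def PiE_iff)
        then have "restrict f {i, j} \<in> PiE {i, j} C" by (simp add: PiE_iff)
        then show ?thesis
          using sym[of "f i" "f j"] sym[of "f j" "f i"] unfolding independent_choices_def by auto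
      qed
      moreover have "f i \<in> C i \<and> f j \<in> C j" if "f \<in> topspace T" for f
        using that \<open>i \<in> J\<close> \<open>j \<in> J\<close> by (simp add: T_def PiE_iff)
      ultimately show ?thesis unfolding P_def by blast
    qed
    also have "closedin T \<dots>"
      by (rule closedin_continuous_map_preimage[OF cm]) (simp, blast)
    finally show ?thesis .
  qed
  define \<U> where "\<U> = (\<lambda>(i, j). P {i, j}) ` (J \<times> J)"
  show ?thesis
  proof (cases "J = {}")
    case True
    then show ?thesis by (intro that[of undefined]) auto
  next
    case False
    have "\<Inter>\<U> \<noteq> {}"
    proof -
      have fip: "\<Inter>\<F> \<noteq> {}" if \<F>: "finite \<F>" "\<F> \<subseteq> \<U>" for \<F>
      proof -
        obtain S where S: "finite S" "S \<subseteq> J \<times> J" "\<F> = (\<lambda>(i, j). P {i, j}) ` S"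
          using finite_subset_image[OF \<F>[unfolded \<U>_def]] by blast
        define A where "A = fst ` S \<union> snd ` S"
        have A: "finite A" "A \<subseteq> J" using S(1,2) by (auto simp: A_def)
        have "independent_choices R C A \<noteq> {}"
          by (rule independent_transversal_finite[OF disj fin big sym deg d A])
        then obtain f where f: "f \<in> independent_choices R C A" by blast
        define g where "g = (\<lambda>j\<in>J. if j \<in> A then f j else SOME v. v \<in> C j)"
        have "C j \<noteq> {}" if "j \<in> J" for j using big[OF that] d by (metis card.empty le_0_eq mult_eq_0_iff neq0_conv zero_neq_numeral)
        then have g: "g \<in> topspace T"
          using f unfolding T_def g_def independent_choices_def
          by (simp add: PiE_iff some_in_eq)
        have "g \<in> P {i, j}" if "(i, j) \<in> S" for i j
        proof -
          have ij: "i \<in> A" "j \<in> A" using that by (force simp: A_def)+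
          then have "restrict g {i, j} = restrict f {i, j}" using A(2) unfolding g_def by (intro restrict_ext) auto
          moreover have "restrict f {i, j} \<in> independent_choices R C {i, j}"
            using ij by (intro independent_choices_restrict[OF f]) auto
          ultimately show ?thesis using g by (simp add: P_def)
        qed
        then have "g \<in> \<Inter>\<F>" unfolding S(3) by blast
        then show ?thesis by blast
      qed
      have "closedin T K" if "K \<in> \<U>" for K
        using that by (auto simp: \<U>_def intro: closed)
      then have "(\<forall>K\<in>\<U>. closedin T K) \<and> (\<forall>\<F>. finite \<F> \<and> \<F> \<subseteq> \<U> \<longrightarrow> \<Inter>\<F> \<noteq> {})"
        by (simp add: fip)
      then show ?thesis
        using T unfolding compact_space_fip by simp
    qed
    then obtain f where "f \<in> \<Inter>\<U>" by blast
    then have f: "f \<in> P {i, j}" if "i \<in> J" "j \<in> J" for i j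
      using that by (force simp: \<U>_def)
    show ?thesis
    proof (rule that[of f])
      show "f j \<in> C j" if "j \<in> J" for j
        using f[OF that that] that by (simp add: P_def T_def PiE_iff)
      show "\<not> R (f i) (f j)" if "i \<in> J" "j \<in> J" "i \<noteq> j" for i j
        using f[OF that(1,2)] that(3) by (simp add: P_def independent_choices_def)
    qed
  qed
qed

lemma maximal_disjoint_extension:
  assumes disj: "disjoint_family_on W M0" and ne: "\<And>x. x \<in> X \<Longrightarrow> W x \<noteq> {}"
  obtains M where "M0 \<subseteq> M" "M \<subseteq> M0 \<union> X" "disjoint_family_on W M"
    "\<And>x. x \<in> X \<Longrightarrow> \<exists>m\<in>M. W x \<inter> W m \<noteq> {}"
proof -
  define \<A> where "\<A> = {M. M0 \<subseteq> M \<and> M \<subseteq> M0 \<union> X \<and> disjoint_family_on W M}"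
  have "\<exists>M\<in>\<A>. \<forall>N\<in>\<A>. M \<subseteq> N \<longrightarrow> N = M"
  proof (rule subset_Zorn_nonempty)
    show "\<A> \<noteq> {}" using disj by (auto simp: \<A>_def)
    fix \<C> assume ne: "\<C> \<noteq> {}" and ch: "subset.chain \<A> \<C>"
    then have sub: "\<C> \<subseteq> \<A>" by (auto simp: subset.chain_def)
    have "W m \<inter> W n = {}" if mn: "m \<in> \<Union>\<C>" "n \<in> \<Union>\<C>" "m \<noteq> n" for m n
    proof -
      obtain N1 N2 where N12: "N1 \<in> \<C>" "m \<in> N1" "N2 \<in> \<C>" "n \<in> N2"
        using mn(1,2) by blast
      then have "N1 \<subseteq> N2 \<or> N2 \<subseteq> N1" using ch by (simp add: subset_chain_def)
      then obtain N where N: "N \<in> \<C>" "m \<in> N" "n \<in> N"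
        using N12 by (metis subsetD)
      then have "disjoint_family_on W N" using sub by (auto simp: \<A>_def)
      then show ?thesis using N mn(3) by (simp add: disjoint_family_on_def)
    qed
    then have "disjoint_family_on W (\<Union>\<C>)" by (simp add: disjoint_family_on_def)
    moreover have "M0 \<subseteq> \<Union>\<C>" "\<Union>\<C> \<subseteq> M0 \<union> X" using ne sub by (auto simp: \<A>_def)
    ultimately show "\<Union>\<C> \<in> \<A>" by (simp add: \<A>_def)
  qed
  then obtain M where M: "M \<in> \<A>" and max: "\<And>N. N \<in> \<A> \<Longrightarrow> M \<subseteq> N \<Longrightarrow> N = M" by metis
  show ?thesis
  proof (rule that[of M])
    show "M0 \<subseteq> M" "M \<subseteq> M0 \<union> X" "disjoint_family_on W M" using M by (auto simp: \<A>_def)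
    show "\<exists>m\<in>M. W x \<inter> W m \<noteq> {}" if x: "x \<in> X" for x
    proof (rule ccontr)
      assume none: "\<not> (\<exists>m\<in>M. W x \<inter> W m \<noteq> {})"
      then have "x \<notin> M" using ne[OF x] by auto
      have "(\<Union>m\<in>M. W m) \<inter> W x = {}" using none by blast
      then have "disjoint_family_on W (insert x M)"
        using disjoint_family_on_insert[OF \<open>x \<notin> M\<close>, of W] M by (simp add: \<A>_def Int_commute)
      then have "insert x M \<in> \<A>" using M x by (auto simp: \<A>_def)
      then have "x \<in> M" using max[of "insert x M"] by auto
      then show False using \<open>x \<notin> M\<close> by simp
    qed
  qed
qed

section \<open>Products of sets in a group\<close>

context group begin

lemma inv_mult_cancel: "x \<in> carrier G \<Longrightarrow> y \<in> carrier G \<Longrightarrow> inv x \<otimes> (x \<otimes> y) = y"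
  by (simp add: m_assoc[symmetric])

lemma in_set_mult: "x \<in> A <#> B \<longleftrightarrow> (\<exists>a\<in>A. \<exists>b\<in>B. x = a \<otimes> b)"
  by (auto simp: set_mult_def)

lemma in_set_inv: "x \<in> set_inv A \<longleftrightarrow> (\<exists>a\<in>A. x = inv a)"
  by (auto simp: SET_INV_def)

lemma in_r_coset: "x \<in> A #> g \<longleftrightarrow> (\<exists>a\<in>A. x = a \<otimes> g)"
  by (auto simp: r_coset_def)

lemma set_multI: "a \<in> A \<Longrightarrow> b \<in> B \<Longrightarrow> a \<otimes> b \<in> A <#> B"
  by (auto simp: set_mult_def)

lemma set_multE:
  assumes "x \<in> A <#> B" obtains a b where "a \<in> A" "b \<in> B" "x = a \<otimes> b"
  using assms unfolding in_set_mult by blast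

lemma set_invI: "a \<in> A \<Longrightarrow> inv a \<in> set_inv A"
  by (auto simp: SET_INV_def)

lemma rcos_image: "a \<in> A \<Longrightarrow> a \<otimes> z \<in> A #> z"
  by (auto simp: r_coset_def)

lemma rcosE:
  assumes "x \<in> A #> g" obtains a where "a \<in> A" "x = a \<otimes> g"
  using assms unfolding in_r_coset by blast

lemma set_inv_closed: "A \<subseteq> carrier G \<Longrightarrow> set_inv A \<subseteq> carrier G"
  by (auto simp: in_set_inv subset_iff)

lemma finite_set_mult: "finite A \<Longrightarrow> finite B \<Longrightarrow> finite (A <#> B)"
  by (auto simp: set_mult_def)

lemma finite_set_inv: "finite A \<Longrightarrow> finite (set_inv A)"
  by (auto simp: SET_INV_def)

lemma card_set_mult_le:
  assumes "finite A" "finite B" shows "card (A <#> B) \<le> card A * card B"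
proof -
  have "A <#> B = (\<lambda>(a, b). a \<otimes> b) ` (A \<times> B)" by (auto simp: set_mult_def)
  then show ?thesis
    using card_image_le[of "A \<times> B" "\<lambda>(a, b). a \<otimes> b"] assms by (simp add: card_cartesian_product)
qed

lemma card_r_coset:
  assumes "A \<subseteq> carrier G" "g \<in> carrier G" shows "card (A #> g) = card A"
proof -
  have "A #> g = (\<lambda>a. a \<otimes> g) ` A" by (auto simp: r_coset_def)
  moreover have "inj_on (\<lambda>a. a \<otimes> g) A" using assms by (intro inj_onI) (metis right_cancel subsetD)
  ultimately show ?thesis by (simp add: card_image)
qed

lemma r_coset_Int:
  assumes "A \<subseteq> carrier G" "B \<subseteq> carrier G" "z \<in> carrier G"
  shows "(A \<inter> B) #> z = (A #> z) \<inter> (B #> z)"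
proof -
  have "a = b" if "a \<in> A" "b \<in> B" "a \<otimes> z = b \<otimes> z" for a b
    using that assms by (metis right_cancel subsetD)
  then have "(A #> z) \<inter> (B #> z) \<subseteq> (A \<inter> B) #> z" unfolding r_coset_def by blast
  then show ?thesis unfolding r_coset_def by blast
qed

lemma r_coset_mono: "A \<subseteq> B \<Longrightarrow> A #> z \<subseteq> B #> z"
  unfolding r_coset_def by blast

lemma apart_sym:
  assumes E: "set_inv E \<subseteq> E" "E \<subseteq> carrier G" and AB: "A \<subseteq> carrier G" "B \<subseteq> carrier G"
    and apart: "A \<inter> (E <#> B) = {}"
  shows "B \<inter> (E <#> A) = {}"
proof (rule ccontr)
  assume "B \<inter> (E <#> A) \<noteq> {}"
  then obtain b where b: "b \<in> B" "b \<in> E <#> A" by blast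
  from b(2) obtain e a where ea: "e \<in> E" "a \<in> A" "b = e \<otimes> a" by (rule set_multE)
  note * = b(1) ea
  have "e \<in> carrier G" "a \<in> carrier G" "b \<in> carrier G" using * E(2) AB by blast+
  then have "a = inv e \<otimes> b" using *(4) by (simp add: inv_solve_left)
  moreover have "inv e \<in> E" using E(1) set_invI[OF *(2)] by (rule subsetD)
  ultimately have "a \<in> E <#> B" using *(1) set_multI by blast
  then show False using *(3) apart by blast
qed

end

section \<open>Partial colourings and levels\<close>

text \<open>
  An atom \<open>(h, i, c)\<close> assigns the colour \<open>c\<close> to the point \<open>h\<close> at coordinate \<open>i\<close>. A level consists of
  the pattern that has to recur, a set \<open>sep\<close> that measures how far copies of it must stay away from
  everything else, and a set \<open>win\<close> whose right translates are the windows.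
\<close>

datatype 'g level =
  Level (pat: "('g \<times> nat \<times> nat) set") (sep: "'g set") (win: "'g set")

abbreviation supp :: "('g \<times> nat \<times> nat) set \<Rightarrow> 'g set" where
  "supp u \<equiv> fst ` u"

text \<open>
  The set \<open>S n\<close> is where the pattern of level \<open>n\<close> has to recur. The last assumption says that \<open>S n\<close>
  is a coset of a subgroup; it gives \<open>win <#> set_inv win <#> win \<subseteq> S n\<close> for \<open>win \<subseteq> S n\<close>.
\<close>

locale windowed_group = group G for G (structure) +
  fixes \<gamma> :: "nat \<Rightarrow> 'a" and S :: "nat \<Rightarrow> 'a set"
  assumes range_\<gamma>: "range \<gamma> = carrier G"
    and S_sub: "S n \<subseteq> carrier G"
    and S_inf: "infinite (S n)"
    and S_coset: "a \<in> S n \<Longrightarrow> b \<in> S n \<Longrightarrow> c \<in> S n \<Longrightarrow> a \<otimes> inv b \<otimes> c \<in> S n"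
begin

text \<open>
  This is the graph of a partial colouring with colours \<open>0, 1, 2\<close> that is proper, at coordinate \<open>i\<close>,
  for the Cayley graph of the single element \<open>\<gamma> i\<close>, unless \<open>\<gamma> i = \<one>\<close>.
\<close>

definition proper :: "('a \<times> nat \<times> nat) set \<Rightarrow> bool" where
  "proper u \<longleftrightarrow>
     (\<forall>h i c. (h, i, c) \<in> u \<longrightarrow> h \<in> carrier G \<and> c < 3) \<and>
     (\<forall>h i c c'. (h, i, c) \<in> u \<longrightarrow> (h, i, c') \<in> u \<longrightarrow> c = c') \<and>
     (\<forall>h i c. (h, i, c) \<in> u \<longrightarrow> (\<gamma> i \<otimes> h, i, c) \<in> u \<longrightarrow> \<gamma> i = \<one>)"

definition translate :: "('a \<times> nat \<times> nat) set \<Rightarrow> 'a \<Rightarrow> ('a \<times> nat \<times> nat) set" where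
  "translate u z = (\<lambda>(h, i, c). (h \<otimes> z, i, c)) ` u"

text \<open>
  A copy of the pattern at \<open>z\<close> comes too close to \<open>U\<close>, in the sense that its support meets
  \<open>sep L <#> U\<close>, exactly if \<open>z\<close> belongs to \<open>block L <#> U\<close>.
\<close>

definition block :: "'a level \<Rightarrow> 'a set" where
  "block L = set_inv (supp (pat L)) <#> sep L"

text \<open>
  The set \<open>reach L <#> U\<close> contains every window that meets a window meeting the blocked set
  \<open>block L <#> U\<close>. So it contains all that level \<open>L\<close> has to know about \<open>U\<close>.
\<close>

definition reach :: "'a level \<Rightarrow> 'a set" where
  "reach L = win L <#> set_inv (win L) <#> win L <#> set_inv (win L) <#> block L"

definition heavy :: "'a level \<Rightarrow> 'a set \<Rightarrow> 'a \<Rightarrow> bool" where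
  "heavy L U g \<longleftrightarrow> card (win L) \<le> 2 * card ((win L #> g) \<inter> (block L <#> U))"

text \<open>
  The windows at \<open>M\<close> are reserved for copies of the pattern. A heavy one must contain its copy
  already, since there may be no room later, but a light one can wait. It matters that the last
  clause only asks for a reserved window next to each heavy window, and not for a copy: the windows
  that do need a copy are then disjoint, and therefore few.
\<close>

definition anchored :: "'a level \<Rightarrow> ('a \<times> nat \<times> nat) set \<Rightarrow> 'a set \<Rightarrow> bool" where
  "anchored L u M \<longleftrightarrow>
     M \<subseteq> carrier G \<and> disjoint_family_on (\<lambda>m. win L #> m) M \<and>
     (\<forall>m\<in>M. win L #> m \<subseteq> reach L <#> supp u) \<and>
     (\<forall>m\<in>M. heavy L (supp u) m \<longrightarrow> (\<exists>z\<in>win L #> m. translate (pat L) z \<subseteq> u)) \<and>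
     (\<forall>g\<in>carrier G. heavy L (supp u) g \<longrightarrow> (\<exists>m\<in>M. (win L #> g) \<inter> (win L #> m) \<noteq> {}))"

definition good :: "(nat \<Rightarrow> 'a level) \<Rightarrow> nat \<Rightarrow> ('a \<times> nat \<times> nat) set \<Rightarrow> bool" where
  "good L n u \<longleftrightarrow> proper u \<and> (\<forall>j<n. \<exists>M. anchored (L j) u M)"

text \<open>
  The factor \<open>2 ^ (n + 3)\<close> makes the windows at least eight times as large as the set that one copy
  of the pattern can block, which leaves enough room for an independent transversal. It also makes
  the costs of the levels decrease geometrically (lemma \<open>card_forced_patterns\<close>).
\<close>

definition admissible :: "(nat \<Rightarrow> 'a level) \<Rightarrow> nat \<Rightarrow> bool" where
  "admissible L n \<longleftrightarrow>
     finite (pat (L n)) \<and> good L n (pat (L n)) \<and> (\<forall>(h, i, c)\<in>pat (L n). i \<le> n) \<and>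
     \<one> \<in> supp (pat (L n)) \<and>
     finite (sep (L n)) \<and> sep (L n) \<subseteq> carrier G \<and> set_inv (sep (L n)) \<subseteq> sep (L n) \<and>
     \<one> \<in> sep (L n) \<and> \<gamma> ` {..n} \<subseteq> sep (L n) \<and>
     (\<forall>j<n. set_inv (reach (L j)) <#> reach (L j) \<subseteq> sep (L n)) \<and>
     finite (win (L n)) \<and> win (L n) \<subseteq> S n \<and>
     2 ^ (n + 3) * (card (block (L n)) * card (supp (pat (L n)))) \<le> card (win (L n))"

lemma properD:
  assumes "proper u"
  shows "(h, i, c) \<in> u \<Longrightarrow> h \<in> carrier G" "(h, i, c) \<in> u \<Longrightarrow> c < 3"
    "(h, i, c) \<in> u \<Longrightarrow> (h, i, c') \<in> u \<Longrightarrow> c = c'"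
    "(h, i, c) \<in> u \<Longrightarrow> (\<gamma> i \<otimes> h, i, c) \<in> u \<Longrightarrow> \<gamma> i = \<one>"
  using assms unfolding proper_def by blast+

lemma supp_proper: "proper u \<Longrightarrow> supp u \<subseteq> carrier G"
  by (auto dest: properD)

lemma \<gamma>_closed [simp, intro]: "\<gamma> i \<in> carrier G"
  using range_\<gamma> by blast

lemma translate_translate:
  assumes "supp u \<subseteq> carrier G" "y \<in> carrier G" "z \<in> carrier G"
  shows "translate (translate u y) z = translate u (y \<otimes> z)"
  unfolding translate_def image_image
  by (rule image_cong) (use assms in \<open>force simp: m_assoc\<close>)+

lemma translate_mono: "u \<subseteq> v \<Longrightarrow> translate u z \<subseteq> translate v z"
  by (auto simp: translate_def)

lemma in_translate: "(h, i, c) \<in> translate u z \<longleftrightarrow> (\<exists>k. (k, i, c) \<in> u \<and> h = k \<otimes> z)"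
  by (force simp: translate_def)

lemma supp_translate: "supp (translate u z) = supp u #> z"
  unfolding translate_def r_coset_def image_image by (auto simp: case_prod_unfold)

lemma proper_subset: "proper u \<Longrightarrow> v \<subseteq> u \<Longrightarrow> proper v"
  unfolding proper_def by (intro conjI allI impI) (use subsetD in metis)+

lemma proper_translate:
  assumes "proper u" "z \<in> carrier G" shows "proper (translate u z)"
proof -
  note P = properD[OF assms(1)]
  show ?thesis
    unfolding proper_def in_translate
  proof (intro conjI allI impI; elim exE conjE)
    fix h i c k assume "(k, i, c) \<in> u" "h = k \<otimes> z"
    then show "h \<in> carrier G" "c < 3" using P assms(2) by auto
  next
    fix h i c c' k k' assume *: "(k, i, c) \<in> u" "h = k \<otimes> z" "(k', i, c') \<in> u" "h = k' \<otimes> z"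
    then have "k = k'" using P(1) assms(2) by (metis right_cancel)
    then show "c = c'" using * P(3) by blast
  next
    fix h i c k k' assume *: "(k, i, c) \<in> u" "h = k \<otimes> z" "(k', i, c) \<in> u" "\<gamma> i \<otimes> h = k' \<otimes> z"
    then have "k \<in> carrier G" "k' \<in> carrier G" using P(1) by auto
    moreover have "(\<gamma> i \<otimes> k) \<otimes> z = k' \<otimes> z" using * assms(2) calculation by (simp add: m_assoc)
    ultimately have "\<gamma> i \<otimes> k = k'" using assms(2) by (metis right_cancel m_closed \<gamma>_closed)
    then show "\<gamma> i = \<one>" using * P(4) by blast
  qed
qed

definition level_in_group :: "'a level \<Rightarrow> bool" where
  "level_in_group L \<longleftrightarrow> supp (pat L) \<subseteq> carrier G \<and> sep L \<subseteq> carrier G \<and> win L \<subseteq> carrier G"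

lemma block_closed: "level_in_group L \<Longrightarrow> block L \<subseteq> carrier G"
  unfolding level_in_group_def block_def by (intro set_mult_closed set_inv_closed) auto

lemma reach_closed: "level_in_group L \<Longrightarrow> reach L \<subseteq> carrier G"
  unfolding reach_def using block_closed[of L]
  by (intro set_mult_closed set_inv_closed) (auto simp: level_in_group_def)

lemma heavy_translate:
  assumes L: "level_in_group L" and "U \<subseteq> carrier G" "g \<in> carrier G" "z \<in> carrier G"
  shows "heavy L (U #> z) (g \<otimes> z) \<longleftrightarrow> heavy L U g"
proof -
  have w: "win L \<subseteq> carrier G" using L by (simp add: level_in_group_def)
  have "(win L #> (g \<otimes> z)) \<inter> (block L <#> (U #> z)) = ((win L #> g) \<inter> (block L <#> U)) #> z"
    using assms w block_closed[OF L]
    by (simp add: coset_mult_assoc[symmetric] setmult_rcos_assoc r_coset_Int r_coset_subset_G set_mult_closed)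
  moreover have "card (((win L #> g) \<inter> (block L <#> U)) #> z) = card ((win L #> g) \<inter> (block L <#> U))"
    using assms w r_coset_subset_G[of "win L" g] by (intro card_r_coset) auto
  ultimately show ?thesis by (simp add: heavy_def)
qed

lemma anchoredD:
  assumes "anchored L u M"
  shows "M \<subseteq> carrier G"
    "\<And>m n. m \<in> M \<Longrightarrow> n \<in> M \<Longrightarrow> m \<noteq> n \<Longrightarrow> (win L #> m) \<inter> (win L #> n) = {}"
    "\<And>m. m \<in> M \<Longrightarrow> win L #> m \<subseteq> reach L <#> supp u"
    "\<And>m. m \<in> M \<Longrightarrow> heavy L (supp u) m \<Longrightarrow> \<exists>z\<in>win L #> m. translate (pat L) z \<subseteq> u"
    "\<And>g. g \<in> carrier G \<Longrightarrow> heavy L (supp u) g \<Longrightarrow> \<exists>m\<in>M. (win L #> g) \<inter> (win L #> m) \<noteq> {}"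
  using assms by (simp_all add: anchored_def disjoint_family_on_def)

lemma anchored_translate:
  assumes L: "level_in_group L" and u: "supp u \<subseteq> carrier G" and z: "z \<in> carrier G"
    and M: "anchored L u M"
  shows "anchored L (translate u z) (M #> z)"
proof -
  have w: "win L \<subseteq> carrier G" and p: "supp (pat L) \<subseteq> carrier G" using L by (auto simp: level_in_group_def)
  have MG: "M \<subseteq> carrier G" using M by (simp add: anchored_def)
  have win: "win L #> (m \<otimes> z) = (win L #> m) #> z" if "m \<in> carrier G" for m
    using coset_mult_assoc[OF w that z] by simp
  have wG: "win L #> m \<subseteq> carrier G" if "m \<in> carrier G" for m
    using r_coset_subset_G[OF w that] .
  have heavy: "heavy L (supp (translate u z)) (g \<otimes> z) \<longleftrightarrow> heavy L (supp u) g" if "g \<in> carrier G" for g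
    using heavy_translate[OF L u that z] by (simp add: supp_translate)
  show ?thesis
    unfolding anchored_def
  proof (intro conjI ballI impI)
    show "M #> z \<subseteq> carrier G" using MG z by (rule r_coset_subset_G)
    show "disjoint_family_on (\<lambda>m. win L #> m) (M #> z)"
      unfolding disjoint_family_on_def
    proof (intro ballI impI)
      fix a b assume "a \<in> M #> z" "b \<in> M #> z" and ne: "a \<noteq> b"
      then obtain m n where mn: "m \<in> M" "n \<in> M" "a = m \<otimes> z" "b = n \<otimes> z" by (auto simp: in_r_coset)
      then have "(win L #> m) \<inter> (win L #> n) = {}"
        using anchoredD(2)[OF M] ne by blast
      moreover have "m \<in> carrier G" "n \<in> carrier G" using mn MG by auto
      ultimately show "(win L #> a) \<inter> (win L #> b) = {}"
        using mn wG z by (simp add: win flip: r_coset_Int) (simp add: r_coset_def)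
    qed
  next
    fix a assume "a \<in> M #> z"
    then obtain m where m: "m \<in> M" "a = m \<otimes> z" "m \<in> carrier G" using MG by (auto simp: in_r_coset)
    have "win L #> m \<subseteq> reach L <#> supp u" using M m by (simp add: anchored_def)
    then have "(win L #> m) #> z \<subseteq> (reach L <#> supp u) #> z" by (rule r_coset_mono)
    then show "win L #> a \<subseteq> reach L <#> supp (translate u z)"
      using m reach_closed[OF L] u z by (simp add: win supp_translate setmult_rcos_assoc)
    assume "heavy L (supp (translate u z)) a"
    then have "heavy L (supp u) m" using heavy m by simp
    then obtain y where y: "y \<in> win L #> m" "translate (pat L) y \<subseteq> u"
      using anchoredD(4)[OF M m(1)] by blast
    have "translate (pat L) (y \<otimes> z) = translate (translate (pat L) y) z"
      using p y wG[OF m(3)] z by (subst translate_translate) auto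
    also have "\<dots> \<subseteq> translate u z" by (intro translate_mono y)
    finally have "translate (pat L) (y \<otimes> z) \<subseteq> translate u z" .
    moreover have "y \<otimes> z \<in> win L #> a"
      unfolding m(2) win[OF m(3)] using y(1) by (rule rcos_image)
    ultimately show "\<exists>y\<in>win L #> a. translate (pat L) y \<subseteq> translate u z" by blast
  next
    fix g assume g: "g \<in> carrier G" and hv: "heavy L (supp (translate u z)) g"
    define k where "k = g \<otimes> inv z"
    have k: "k \<in> carrier G" "g = k \<otimes> z" using g z by (auto simp: k_def m_assoc)
    have "heavy L (supp u) k" using hv heavy k by simp
    then obtain m where m: "m \<in> M" "(win L #> k) \<inter> (win L #> m) \<noteq> {}"
      using anchoredD(5)[OF M k(1)] by blast
    have mG: "m \<in> carrier G" using m MG by auto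
    obtain x where x: "x \<in> win L #> k" "x \<in> win L #> m" using m(2) by blast
    have "x \<otimes> z \<in> win L #> g"
      unfolding k(2) win[OF k(1)] using x(1) by (rule rcos_image)
    moreover have "x \<otimes> z \<in> win L #> (m \<otimes> z)"
      unfolding win[OF mG] using x(2) by (rule rcos_image)
    moreover have "m \<otimes> z \<in> M #> z" using m(1) by (rule rcos_image)
    ultimately have "x \<otimes> z \<in> (win L #> g) \<inter> (win L #> (m \<otimes> z))" "m \<otimes> z \<in> M #> z" by simp_all
    then show "\<exists>m\<in>M #> z. (win L #> g) \<inter> (win L #> m) \<noteq> {}" by (metis empty_iff)
  qed
qed

lemma goodD:
  assumes "good L n u"
  shows "proper u" "supp u \<subseteq> carrier G" "\<And>j. j < n \<Longrightarrow> \<exists>M. anchored (L j) u M"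
proof -
  show "proper u" using assms by (simp add: good_def)
  then show "supp u \<subseteq> carrier G" by (rule supp_proper)
  show "\<And>j. j < n \<Longrightarrow> \<exists>M. anchored (L j) u M" using assms by (simp add: good_def)
qed

lemma good_translate:
  assumes L: "\<And>j. j < n \<Longrightarrow> level_in_group (L j)" and u: "good L n u" and z: "z \<in> carrier G"
  shows "good L n (translate u z)"
  unfolding good_def
proof (intro conjI allI impI)
  show "proper (translate u z)" using goodD(1)[OF u] z by (rule proper_translate)
  fix j assume j: "j < n"
  then obtain M where "anchored (L j) u M" using goodD(3)[OF u] by blast
  then show "\<exists>M. anchored (L j) (translate u z) M"
    using anchored_translate[OF L[OF j] goodD(2)[OF u] z] by blast
qed

lemma admissibleD:
  assumes "admissible L n"
  shows "finite (pat (L n))" "good L n (pat (L n))" "\<And>h i c. (h, i, c) \<in> pat (L n) \<Longrightarrow> i \<le> n"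
     "\<one> \<in> supp (pat (L n))"
     "finite (sep (L n))" "sep (L n) \<subseteq> carrier G" "set_inv (sep (L n)) \<subseteq> sep (L n)"
     "\<one> \<in> sep (L n)" "\<And>i. i \<le> n \<Longrightarrow> \<gamma> i \<in> sep (L n)"
     "\<And>j. j < n \<Longrightarrow> set_inv (reach (L j)) <#> reach (L j) \<subseteq> sep (L n)"
     "finite (win (L n))" "win (L n) \<subseteq> S n" "win (L n) \<subseteq> carrier G"
     "2 ^ (n + 3) * (card (block (L n)) * card (supp (pat (L n)))) \<le> card (win (L n))"
     "proper (pat (L n))" "level_in_group (L n)"
proof -
  note A = assms[unfolded admissible_def]
  show *: "finite (pat (L n))" "good L n (pat (L n))" "\<one> \<in> supp (pat (L n))"
     "finite (sep (L n))" "sep (L n) \<subseteq> carrier G" "set_inv (sep (L n)) \<subseteq> sep (L n)"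
     "\<one> \<in> sep (L n)" "finite (win (L n))" "win (L n) \<subseteq> S n"
     "2 ^ (n + 3) * (card (block (L n)) * card (supp (pat (L n)))) \<le> card (win (L n))"
     "\<And>j. j < n \<Longrightarrow> set_inv (reach (L j)) <#> reach (L j) \<subseteq> sep (L n)"
    using A by simp_all
  have "\<forall>(h, i, c)\<in>pat (L n). i \<le> n" "\<gamma> ` {..n} \<subseteq> sep (L n)" using A by simp_all
  then show "\<And>h i c. (h, i, c) \<in> pat (L n) \<Longrightarrow> i \<le> n" "\<And>i. i \<le> n \<Longrightarrow> \<gamma> i \<in> sep (L n)"
    by auto
  show "win (L n) \<subseteq> carrier G" using *(9) S_sub by (rule subset_trans)
  then show "level_in_group (L n)" using *(5) goodD(2)[OF *(2)] by (simp add: level_in_group_def)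
  show "proper (pat (L n))" using *(2) by (rule goodD(1))
qed

lemma one_in_block:
  assumes "admissible L n" shows "\<one> \<in> block (L n)"
proof -
  have "inv \<one> \<in> set_inv (supp (pat (L n)))"
    using admissibleD(4)[OF assms] by (rule set_invI)
  then have "inv \<one> \<otimes> \<one> \<in> block (L n)"
    unfolding block_def using admissibleD(8)[OF assms] by (rule set_multI)
  then show ?thesis by simp
qed

lemma finite_block:
  assumes "admissible L n" shows "finite (block (L n))"
  unfolding block_def using admissibleD(1,5)[OF assms]
  by (intro finite_set_mult finite_set_inv finite_imageI)

lemma finite_reach:
  assumes "admissible L n" shows "finite (reach (L n))"
  unfolding reach_def using admissibleD(11)[OF assms] finite_block[OF assms]
  by (intro finite_set_mult finite_set_inv)

lemma card_block_supp_pos: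
  assumes "admissible L n" shows "card (block (L n)) * card (supp (pat (L n))) > 0"
proof -
  have "block (L n) \<noteq> {}" "finite (block (L n))"
    using one_in_block[OF assms] finite_block[OF assms] by auto
  moreover have "supp (pat (L n)) \<noteq> {}" "finite (supp (pat (L n)))"
    using admissibleD(1,4)[OF assms] by auto
  ultimately show ?thesis by (simp add: card_gt_0_iff)
qed

lemma win_nonempty:
  assumes "admissible L n" shows "card (win (L n)) > 0" "win (L n) \<noteq> {}"
proof -
  have "0 < (2::nat) ^ (n + 3) * (card (block (L n)) * card (supp (pat (L n))))"
    using card_block_supp_pos[OF assms] by simp
  with admissibleD(14)[OF assms] show "card (win (L n)) > 0" by linarith
  then show "win (L n) \<noteq> {}" by auto
qed

lemma meeting_window_in_reach:
  assumes L: "level_in_group L" and U: "U \<subseteq> carrier G" and g: "g \<in> carrier G" and m: "m \<in> carrier G"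
    and ne: "(win L #> g) \<inter> (block L <#> U) \<noteq> {}" and meet: "(win L #> g) \<inter> (win L #> m) \<noteq> {}"
  shows "win L #> m \<subseteq> reach L <#> U"
proof
  have w: "win L \<subseteq> carrier G" using L by (simp add: level_in_group_def)
  fix x assume "x \<in> win L #> m"
  then obtain r where r: "r \<in> win L" "x = r \<otimes> m" by (rule rcosE)
  obtain y where y: "y \<in> win L #> g" "y \<in> win L #> m" using meet by blast
  obtain k where k: "k \<in> win L" "y = k \<otimes> g" using y(1) by (rule rcosE)
  obtain k' where k': "k' \<in> win L" "y = k' \<otimes> m" using y(2) by (rule rcosE)
  obtain t where t: "t \<in> win L #> g" "t \<in> block L <#> U" using ne by blast
  obtain l where l: "l \<in> win L" "t = l \<otimes> g" using t(1) by (rule rcosE)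
  obtain q a where q: "q \<in> block L" "a \<in> U" "t = q \<otimes> a" using t(2) by (rule set_multE)
  have cl: "r \<in> carrier G" "k \<in> carrier G" "k' \<in> carrier G" "l \<in> carrier G" "q \<in> carrier G" "a \<in> carrier G"
    using r(1) k(1) k'(1) l(1) q(1,2) w U block_closed[OF L] by blast+
  have "g = inv l \<otimes> (q \<otimes> a)" using l q cl g by (metis inv_mult_cancel)
  moreover have "m = inv k' \<otimes> (k \<otimes> g)" using k k' cl m by (metis inv_mult_cancel)
  ultimately have "x = r \<otimes> (inv k' \<otimes> (k \<otimes> (inv l \<otimes> (q \<otimes> a))))" using r by simp
  then have "x = (r \<otimes> inv k' \<otimes> k \<otimes> inv l \<otimes> q) \<otimes> a" using cl by (simp add: m_assoc)
  moreover have "r \<otimes> inv k' \<otimes> k \<otimes> inv l \<otimes> q \<in> reach L"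
    unfolding reach_def using r k k' l q by (intro set_multI set_invI)
  ultimately show "x \<in> reach L <#> U" using q(2) set_multI by simp
qed

lemma window_in_reach:
  assumes L: "level_in_group L" and U: "U \<subseteq> carrier G" and g: "g \<in> carrier G"
    and ne: "(win L #> g) \<inter> (block L <#> U) \<noteq> {}"
  shows "win L #> g \<subseteq> reach L <#> U"
proof (rule meeting_window_in_reach[OF L U g g ne])
  show "(win L #> g) \<inter> (win L #> g) \<noteq> {}" using ne by blast
qed

lemma block_in_reach:
  assumes L: "level_in_group L" and ne: "win L \<noteq> {}"
  shows "block L <#> U \<subseteq> reach L <#> U"
proof -
  obtain k where k: "k \<in> win L" using ne by blast
  have "q \<in> reach L" if q: "q \<in> block L" for q
  proof -
    have "k \<in> carrier G" "q \<in> carrier G" using k q L block_closed[OF L] by (auto simp: level_in_group_def)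
    then have "q = k \<otimes> inv k \<otimes> k \<otimes> inv k \<otimes> q" by (simp add: m_assoc)
    then show ?thesis unfolding reach_def using k q by (metis set_multI set_invI)
  qed
  then show ?thesis by (intro mono_set_mult) auto
qed

lemma heavy_mono:
  assumes "heavy L U g" "U \<subseteq> V" "finite (win L)" shows "heavy L V g"
proof -
  have "(win L #> g) \<inter> (block L <#> U) \<subseteq> (win L #> g) \<inter> (block L <#> V)"
    using mono_set_mult[OF order_refl assms(2)] by blast
  moreover have "finite (win L #> g)" using assms(3) by (auto simp: r_coset_def)
  ultimately have "card ((win L #> g) \<inter> (block L <#> U)) \<le> card ((win L #> g) \<inter> (block L <#> V))"
    by (intro card_mono) auto
  then show ?thesis using assms(1) by (simp add: heavy_def)
qed

lemma heavy_meets_block: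
  assumes "admissible L n" "heavy (L n) U g" shows "(win (L n) #> g) \<inter> (block (L n) <#> U) \<noteq> {}"
  using win_nonempty(1)[OF assms(1)] assms(2) unfolding heavy_def
  by (metis card.empty le_0_eq mult_0_right not_gr_zero)

section \<open>Combining good colourings\<close>

lemma zones_disjoint:
  assumes L: "level_in_group L" and E: "set_inv (reach L) <#> reach L \<subseteq> E"
    and AB: "A \<subseteq> carrier G" "B \<subseteq> carrier G" and apart: "A \<inter> (E <#> B) = {}"
  shows "(reach L <#> A) \<inter> (reach L <#> B) = {}"
proof (rule ccontr)
  assume "(reach L <#> A) \<inter> (reach L <#> B) \<noteq> {}"
  then obtain x where x: "x \<in> reach L <#> A" "x \<in> reach L <#> B" by blast
  obtain r a where ra: "r \<in> reach L" "a \<in> A" "x = r \<otimes> a" using x(1) by (rule set_multE)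
  obtain s b where sb: "s \<in> reach L" "b \<in> B" "x = s \<otimes> b" using x(2) by (rule set_multE)
  have *: "r \<in> reach L" "a \<in> A" "s \<in> reach L" "b \<in> B" "r \<otimes> a = s \<otimes> b" using ra sb by simp_all
  have cl: "r \<in> carrier G" "a \<in> carrier G" "s \<in> carrier G" "b \<in> carrier G"
    using * AB reach_closed[OF L] by auto
  then have "a = inv r \<otimes> (s \<otimes> b)" using *(5) by (simp add: inv_solve_left)
  then have "a = (inv r \<otimes> s) \<otimes> b" using cl by (simp add: m_assoc)
  moreover have "inv r \<otimes> s \<in> E" using E set_multI[OF set_invI[OF *(1)] *(3)] by (rule subsetD)
  ultimately have "a \<in> E <#> B" using *(4) set_multI by blast
  then show False using *(2) apart by blast
qed

text \<open>
  At each level \<open>j < n\<close>, all windows that matter for a piece \<open>u\<close> lie in its zone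
  \<open>reach (L j) <#> supp u\<close>. The zones of different pieces are disjoint because \<open>sep (L n)\<close> contains
  \<open>set_inv (reach (L j)) <#> reach (L j)\<close>. Hence being heavy for the union is the same as being heavy
  for the piece in whose zone the window lies. Two pieces share only coordinates \<open>i \<le> n\<close>, and there
  \<open>\<gamma> i \<in> sep (L n)\<close> keeps them from violating properness.
\<close>

lemma good_Union:
  assumes L: "\<And>j. j \<le> n \<Longrightarrow> admissible L j"
    and F: "\<And>u. u \<in> F \<Longrightarrow> good L n u"
    and apart: "\<And>u v. u \<in> F \<Longrightarrow> v \<in> F \<Longrightarrow> u \<noteq> v \<Longrightarrow> supp u \<inter> (sep (L n) <#> supp v) = {}"
    and low: "\<And>u v h i c h' c'. u \<in> F \<Longrightarrow> v \<in> F \<Longrightarrow> u \<noteq> v \<Longrightarrow> (h, i, c) \<in> u \<Longrightarrow> (h', i, c') \<in> v \<Longrightarrow> i \<le> n"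
  shows "good L n (\<Union>F)"
  unfolding good_def
proof (intro conjI allI impI)
  have FG: "supp u \<subseteq> carrier G" if "u \<in> F" for u using goodD(2)[OF F[OF that]] .
  note P = properD[OF goodD(1)[OF F]]
  have same: "u = v" if uv: "u \<in> F" "v \<in> F" "x \<in> u" "y \<in> v" "d \<in> sep (L n)" "fst x = d \<otimes> fst y" for u v x y d
  proof (rule ccontr)
    assume "u \<noteq> v"
    moreover have "fst x \<in> sep (L n) <#> supp v" unfolding uv(6) using uv(4,5) by (intro set_multI imageI)
    moreover have "fst x \<in> supp u" using uv(3) by (rule imageI)
    ultimately show False using apart[OF uv(1,2)] by blast
  qed
  show "proper (\<Union>F)"
    unfolding proper_def
  proof (intro conjI allI impI)
    fix h i c assume "(h, i, c) \<in> \<Union>F"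
    then obtain u where u: "u \<in> F" "(h, i, c) \<in> u" by blast
    show "h \<in> carrier G" "c < 3" using P(1,2)[OF u] .
    fix c' assume "(h, i, c') \<in> \<Union>F"
    then obtain v where v: "v \<in> F" "(h, i, c') \<in> v" by blast
    have "u = v"
      using same[OF u(1) v(1) u(2) v(2) admissibleD(8)[OF L[OF order_refl]]] P(1)[OF u] by simp
    with v(2) have "(h, i, c') \<in> u" by simp
    then show "c = c'" by (rule P(3)[OF u])
  next
    fix h i c assume "(h, i, c) \<in> \<Union>F" "(\<gamma> i \<otimes> h, i, c) \<in> \<Union>F"
    then obtain u v where u: "u \<in> F" "(h, i, c) \<in> u" and v: "v \<in> F" "(\<gamma> i \<otimes> h, i, c) \<in> v" by blast
    have "v = u"
    proof (rule ccontr)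
      assume "v \<noteq> u"
      then have "i \<le> n" using low[OF v(1) u(1) _ v(2) u(2)] by simp
      then have "\<gamma> i \<in> sep (L n)" by (rule admissibleD(9)[OF L[OF order_refl]])
      then show False using same[OF v(1) u(1) v(2) u(2), of "\<gamma> i"] \<open>v \<noteq> u\<close> by simp
    qed
    with v(2) have "(\<gamma> i \<otimes> h, i, c) \<in> u" by simp
    then show "\<gamma> i = \<one>" by (rule P(4)[OF u])
  qed
next
  fix j assume j: "j < n"
  have Lj: "admissible L j" "level_in_group (L j)" using L[of j] admissibleD(16) j by simp_all
  have FG: "supp u \<subseteq> carrier G" if "u \<in> F" for u using goodD(2)[OF F[OF that]] .
  have "\<forall>u\<in>F. \<exists>M. anchored (L j) u M" using goodD(3)[OF F] j by blast
  then obtain M where M: "\<And>u. u \<in> F \<Longrightarrow> anchored (L j) u (M u)" by metis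
  have zones: "(reach (L j) <#> supp u) \<inter> (reach (L j) <#> supp v) = {}"
    if "u \<in> F" "v \<in> F" "u \<noteq> v" for u v
    using that j by (intro zones_disjoint[OF Lj(2) admissibleD(10)[OF L[OF order_refl]]] FG apart)
  have UF: "block (L j) <#> supp (\<Union>F) = (\<Union>u\<in>F. block (L j) <#> supp u)"
    unfolding set_mult_def by blast
  have heavyI: "heavy (L j) (supp u) g"
    if "heavy (L j) (supp (\<Union>F)) g" "u \<in> F" "win (L j) #> g \<subseteq> reach (L j) <#> supp u" for u g
  proof -
    have "(win (L j) #> g) \<inter> (block (L j) <#> supp v) = {}" if "v \<in> F" "v \<noteq> u" for v
      using zones[OF \<open>u \<in> F\<close> that(1)] that(2) block_in_reach[OF Lj(2) win_nonempty(2)[OF Lj(1)], of "supp v"]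
        \<open>win (L j) #> g \<subseteq> _\<close> by blast
    then have "(win (L j) #> g) \<inter> (block (L j) <#> supp (\<Union>F)) = (win (L j) #> g) \<inter> (block (L j) <#> supp u)"
      unfolding UF using \<open>u \<in> F\<close> by blast
    then show ?thesis using that(1) by (simp add: heavy_def)
  qed
  have "anchored (L j) (\<Union>F) (\<Union>u\<in>F. M u)"
    unfolding anchored_def disjoint_family_on_def
  proof (intro conjI ballI impI)
    show "(\<Union>u\<in>F. M u) \<subseteq> carrier G" using anchoredD(1)[OF M] by blast
  next
    fix m m' assume "m \<in> (\<Union>u\<in>F. M u)" "m' \<in> (\<Union>u\<in>F. M u)" and ne: "m \<noteq> m'"
    then obtain u v where u: "u \<in> F" "m \<in> M u" and v: "v \<in> F" "m' \<in> M v" by blast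
    show "(win (L j) #> m) \<inter> (win (L j) #> m') = {}"
    proof (cases "u = v")
      case True
      then show ?thesis using anchoredD(2)[OF M[OF u(1)] u(2)] v ne by blast
    next
      case False
      then show ?thesis
        using anchoredD(3)[OF M[OF u(1)] u(2)] anchoredD(3)[OF M[OF v(1)] v(2)] zones[OF u(1) v(1)]
        by blast
    qed
  next
    fix m assume "m \<in> (\<Union>u\<in>F. M u)"
    then obtain u where u: "u \<in> F" "m \<in> M u" by blast
    note near = anchoredD(3)[OF M[OF u(1)] u(2)]
    have "reach (L j) <#> supp u \<subseteq> reach (L j) <#> supp (\<Union>F)"
      using u(1) by (intro mono_set_mult) auto
    with near show "win (L j) #> m \<subseteq> reach (L j) <#> supp (\<Union>F)" by blast
    assume "heavy (L j) (supp (\<Union>F)) m"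
    then have "heavy (L j) (supp u) m" using heavyI u(1) near by blast
    then obtain z where z: "z \<in> win (L j) #> m" "translate (pat (L j)) z \<subseteq> u"
      using anchoredD(4)[OF M[OF u(1)] u(2)] by blast
    show "\<exists>z\<in>win (L j) #> m. translate (pat (L j)) z \<subseteq> \<Union>F"
    proof (rule bexI[OF _ z(1)])
      show "translate (pat (L j)) z \<subseteq> \<Union>F" using z(2) u(1) by blast
    qed
  next
    fix g assume g: "g \<in> carrier G" and hv: "heavy (L j) (supp (\<Union>F)) g"
    then have "(win (L j) #> g) \<inter> (block (L j) <#> supp (\<Union>F)) \<noteq> {}"
      using win_nonempty(1)[OF Lj(1)] unfolding heavy_def by (metis card.empty le_0_eq mult_0_right not_gr_zero)
    then obtain u where u: "u \<in> F" "(win (L j) #> g) \<inter> (block (L j) <#> supp u) \<noteq> {}"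
      unfolding UF by blast
    then have "win (L j) #> g \<subseteq> reach (L j) <#> supp u"
      using window_in_reach[OF Lj(2) FG[OF u(1)] g] by blast
    then have "heavy (L j) (supp u) g" using heavyI hv u(1) by blast
    then obtain m where "m \<in> M u" "(win (L j) #> g) \<inter> (win (L j) #> m) \<noteq> {}"
      using anchoredD(5)[OF M[OF u(1)] g] by blast
    then show "\<exists>m\<in>(\<Union>u\<in>F. M u). (win (L j) #> g) \<inter> (win (L j) #> m) \<noteq> {}"
      using u(1) by blast
  qed
  then show "\<exists>M. anchored (L j) (\<Union>F) M" ..
qed

lemma apart_pattern:
  assumes L: "admissible L n" and z: "z \<in> carrier G" and U: "U \<subseteq> carrier G"
    and free: "z \<notin> block (L n) <#> U"
  shows "supp (translate (pat (L n)) z) \<inter> (sep (L n) <#> U) = {}"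
proof (rule ccontr)
  assume "supp (translate (pat (L n)) z) \<inter> (sep (L n) <#> U) \<noteq> {}"
  then obtain x where x: "x \<in> supp (pat (L n)) #> z" "x \<in> sep (L n) <#> U"
    unfolding supp_translate by blast
  obtain b where b: "b \<in> supp (pat (L n))" "x = b \<otimes> z" using x(1) by (rule rcosE)
  obtain d a where da: "d \<in> sep (L n)" "a \<in> U" "x = d \<otimes> a" using x(2) by (rule set_multE)
  have *: "b \<in> supp (pat (L n))" "d \<in> sep (L n)" "a \<in> U" "b \<otimes> z = d \<otimes> a" using b da by simp_all
  have cl: "b \<in> carrier G" "d \<in> carrier G" "a \<in> carrier G"
    using *(1-3) admissibleD(6,16)[OF L] U by (auto simp: level_in_group_def)
  then have "z = inv b \<otimes> (d \<otimes> a)" using *(4) z by (simp add: inv_solve_left)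
  then have "z = (inv b \<otimes> d) \<otimes> a" using cl by (simp add: m_assoc)
  moreover have "inv b \<otimes> d \<in> block (L n)"
    unfolding block_def using * by (intro set_multI set_invI)
  ultimately show False using free *(3) set_multI by blast
qed

lemma good_add_patterns:
  assumes L: "\<And>j. j \<le> n \<Longrightarrow> admissible L j" and u: "good L n u" and Z: "Z \<subseteq> carrier G"
    and free: "\<And>z. z \<in> Z \<Longrightarrow> z \<notin> block (L n) <#> supp u"
    and indep: "\<And>z z'. z \<in> Z \<Longrightarrow> z' \<in> Z \<Longrightarrow> z \<noteq> z' \<Longrightarrow>
      z \<notin> block (L n) <#> (supp (pat (L n)) #> z')"
  shows "good L n (u \<union> (\<Union>z\<in>Z. translate (pat (L n)) z))"
proof -
  note A = admissibleD[OF L[OF order_refl]]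
  let ?T = "translate (pat (L n))"
  have tG: "supp (?T z) \<subseteq> carrier G" if "z \<in> Z" for z
    unfolding supp_translate using that Z A(16) by (intro r_coset_subset_G) (auto simp: level_in_group_def)
  have uG: "supp u \<subseteq> carrier G" using goodD(2)[OF u] .
  have a1: "supp (?T z) \<inter> (sep (L n) <#> supp u) = {}" if "z \<in> Z" for z
    using apart_pattern[OF L[OF order_refl] _ uG free[OF that]] that Z by blast
  then have a2: "supp u \<inter> (sep (L n) <#> supp (?T z)) = {}" if "z \<in> Z" for z
    using that by (intro apart_sym[OF A(7,6) tG uG])
  have a3: "supp (?T z) \<inter> (sep (L n) <#> supp (?T z')) = {}" if "z \<in> Z" "z' \<in> Z" "?T z \<noteq> ?T z'" for z z'
  proof -
    have "z \<notin> block (L n) <#> (supp (pat (L n)) #> z')" using indep that by blast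
    then have free': "z \<notin> block (L n) <#> supp (?T z')" unfolding supp_translate .
    have "z \<in> carrier G" using that(1) Z by blast
    then show ?thesis by (rule apart_pattern[OF L[OF order_refl] _ tG[OF that(2)] free'])
  qed
  have lowT: "i \<le> n" if "(h, i, c) \<in> ?T z" for h i c z
    using that A(3) unfolding in_translate by blast
  have "good L n (\<Union>(insert u (?T ` Z)))"
  proof (rule good_Union[OF L])
    show "good L n v" if vF: "v \<in> insert u (?T ` Z)" for v
    proof (cases "v = u")
      case False
      then obtain z where z: "z \<in> Z" "v = ?T z" using vF by blast
      have "z \<in> carrier G" using z(1) Z by blast
      then show ?thesis
        unfolding z(2) using L A(2) by (intro good_translate admissibleD(16)) simp_all
    qed (use u in simp)
    show "supp v \<inter> (sep (L n) <#> supp w) = {}"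
      if "v \<in> insert u (?T ` Z)" "w \<in> insert u (?T ` Z)" "v \<noteq> w" for v w
      using that a1 a2 a3 by (elim insertE imageE) simp_all
    show "i \<le> n" if "v \<in> insert u (?T ` Z)" "w \<in> insert u (?T ` Z)" "v \<noteq> w"
      "(h, i, c) \<in> v" "(h', i, c') \<in> w" for v w h i c h' c'
      using that lowT by (elim insertE imageE) blast+
  qed
  moreover have "\<Union>(insert u (?T ` Z)) = u \<union> (\<Union>z\<in>Z. ?T z)" by simp
  ultimately show ?thesis by simp
qed

section \<open>Filling up\<close>

definition saturated :: "'a level \<Rightarrow> ('a \<times> nat \<times> nat) set \<Rightarrow> 'a set \<Rightarrow> bool" where
  "saturated L u M \<longleftrightarrow>
     M \<subseteq> carrier G \<and> disjoint_family_on (\<lambda>m. win L #> m) M \<and>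
     (\<forall>m\<in>M. \<exists>z\<in>win L #> m. translate (pat L) z \<subseteq> u) \<and>
     (\<forall>g\<in>carrier G. \<exists>m\<in>M. (win L #> g) \<inter> (win L #> m) \<noteq> {})"

lemma saturated_mono: "saturated L u M \<Longrightarrow> u \<subseteq> v \<Longrightarrow> saturated L v M"
  unfolding saturated_def by (meson subset_trans)

lemma pattern_conflict_sym:
  assumes L: "admissible L n" and z: "z \<in> carrier G" "y \<in> carrier G"
    and conf: "z \<in> block (L n) <#> (supp (pat (L n)) #> y)"
  shows "y \<in> block (L n) <#> (supp (pat (L n)) #> z)"
proof -
  note A = admissibleD[OF L]
  obtain q x where q: "q \<in> block (L n)" "x \<in> supp (pat (L n)) #> y" "z = q \<otimes> x"
    using conf by (rule set_multE)
  obtain b where b: "b \<in> supp (pat (L n))" "x = b \<otimes> y" using q(2) by (rule rcosE)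
  obtain i d where i: "i \<in> set_inv (supp (pat (L n)))" "d \<in> sep (L n)" "q = i \<otimes> d"
    using q(1) unfolding block_def by (rule set_multE)
  obtain a where a: "a \<in> supp (pat (L n))" "i = inv a" using i(1) in_set_inv by auto
  have cl: "a \<in> carrier G" "b \<in> carrier G" "d \<in> carrier G"
    using a b i A(6,16) by (auto simp: level_in_group_def)
  have "inv d \<in> sep (L n)" using A(7) set_invI[OF i(2)] by (rule subsetD)
  then have m: "inv b \<otimes> inv d \<otimes> (a \<otimes> z) \<in> block (L n) <#> (supp (pat (L n)) #> z)"
    unfolding block_def using a(1) b(1) by (intro set_multI set_invI rcos_image)
  have "a \<otimes> z = d \<otimes> (b \<otimes> y)" using q b i a cl z by (simp add: m_assoc inv_solve_left)
  then have "inv b \<otimes> inv d \<otimes> (a \<otimes> z) = inv b \<otimes> (inv d \<otimes> (d \<otimes> (b \<otimes> y)))"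
    using cl z by (simp add: m_assoc)
  also have "\<dots> = y" using cl z by (simp add: inv_mult_cancel)
  finally show ?thesis using m by simp
qed

lemma light_window_choices:
  assumes L: "admissible L n" and m: "m \<in> carrier G" and light: "\<not> heavy (L n) U m"
  shows "4 * (card (block (L n)) * card (supp (pat (L n)))) \<le> card ((win (L n) #> m) - (block (L n) <#> U))"
proof -
  note A = admissibleD[OF L]
  let ?W = "win (L n) #> m"
  have fin: "finite ?W" using A(11) by (auto simp: r_coset_def)
  have "card ?W = card (win (L n))" using A(13) m by (rule card_r_coset)
  moreover have "card (?W - (block (L n) <#> U)) = card ?W - card (?W \<inter> (block (L n) <#> U))"
    using fin by (simp add: card_Diff_subset_Int)
  moreover have "2 * card (?W \<inter> (block (L n) <#> U)) < card (win (L n))"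
    using light by (simp add: heavy_def)
  moreover have "8 * (card (block (L n)) * card (supp (pat (L n))))
      \<le> 2 ^ (n + 3) * (card (block (L n)) * card (supp (pat (L n))))"
  proof (rule mult_le_mono1)
    have "(2::nat) ^ 3 \<le> 2 ^ (n + 3)" by (rule power_increasing) auto
    then show "(8::nat) \<le> 2 ^ (n + 3)" by simp
  qed
  ultimately show ?thesis using A(14) by linarith
qed

text \<open>
  The reserved windows are completed by light windows to a maximal disjoint family. All windows
  without a copy of the pattern are then light, so that half of each is free, and an independent
  transversal of the free parts gives positions for the missing copies. Afterwards level \<open>n\<close> is
  settled for the whole group, and the new colouring still is good for the levels below.
\<close>

lemma fill_level:
  assumes L: "\<And>j. j \<le> n \<Longrightarrow> admissible L j" and u: "good L (Suc n) u"
  obtains v M where "u \<subseteq> v" "good L n v" "saturated (L n) v M"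
proof -
  note Ln = L[OF order_refl]
  note A = admissibleD[OF Ln]
  let ?W = "\<lambda>m. win (L n) #> m" and ?T = "translate (pat (L n))"
  let ?B = "block (L n)" and ?P = "supp (pat (L n))"
  let ?d = "card ?B * card ?P"
  obtain M0 where M0: "anchored (L n) u M0" using goodD(3)[OF u] by blast
  define X where "X = {g \<in> carrier G. \<not> heavy (L n) (supp u) g}"
  have Wne: "?W m \<noteq> {}" for m using win_nonempty(2)[OF Ln] by (auto simp: r_coset_def)
  have "disjoint_family_on ?W M0" using M0 by (simp add: anchored_def)
  then obtain M where M: "M0 \<subseteq> M" "M \<subseteq> M0 \<union> X" "disjoint_family_on ?W M"
    and meet: "\<And>x. x \<in> X \<Longrightarrow> \<exists>m\<in>M. ?W x \<inter> ?W m \<noteq> {}"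
    using maximal_disjoint_extension[of ?W M0 X] Wne by metis
  have MG: "M \<subseteq> carrier G" using M(2) anchoredD(1)[OF M0] by (auto simp: X_def)
  define J where "J = {m \<in> M. \<not> (\<exists>z\<in>?W m. ?T z \<subseteq> u)}"
  define C where "C m = ?W m - (?B <#> supp u)" for m
  define R where "R z y \<longleftrightarrow> z \<in> carrier G \<and> y \<in> carrier G \<and> z \<in> ?B <#> (?P #> y)" for z y
  have WG: "?W m \<subseteq> carrier G" if "m \<in> M" for m
    using r_coset_subset_G[OF A(13)] that MG by blast
  have Rsym: "R y z" if "R z y" for z y
    using that pattern_conflict_sym[OF Ln] by (simp add: R_def)
  have Rdeg: "finite {w. R v w} \<and> card {w. R v w} \<le> ?d" for v
  proof -
    have sub: "{w. R v w} \<subseteq> ?B <#> (?P #> v)" using Rsym by (auto simp: R_def)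
    have fin: "finite ?B" "finite (?P #> v)" using finite_block[OF Ln] A(1) by (auto simp: r_coset_def)
    have "card (?P #> v) \<le> card ?P"
      using A(1) card_image_le[of ?P "\<lambda>h. h \<otimes> v"] by (simp add: r_coset_def UNION_singleton_eq_range)
    then have "card (?B <#> (?P #> v)) \<le> ?d"
      using card_set_mult_le[OF fin] by (meson le_trans mult_le_mono2)
    moreover have "finite (?B <#> (?P #> v))" using fin by (rule finite_set_mult)
    ultimately show ?thesis using sub by (meson card_mono finite_subset le_trans)
  qed
  \<comment> \<open>The windows reserved by \<open>u\<close> that are heavy contain a copy already.\<close>
  have light: "\<not> heavy (L n) (supp u) m" if "m \<in> J" for m
  proof
    assume h: "heavy (L n) (supp u) m"
    have "m \<in> M0" using that M(2) h by (auto simp: J_def X_def)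
    then show False using anchoredD(4)[OF M0 _ h] that by (auto simp: J_def)
  qed
  have JG: "m \<in> carrier G" if "m \<in> J" for m using that MG by (auto simp: J_def)
  obtain f where f: "\<And>m. m \<in> J \<Longrightarrow> f m \<in> C m"
      "\<And>m m'. m \<in> J \<Longrightarrow> m' \<in> J \<Longrightarrow> m \<noteq> m' \<Longrightarrow> \<not> R (f m) (f m')"
  proof (rule independent_transversal[of C J ?d R])
    show "disjoint_family_on C J"
      using M(3) unfolding disjoint_family_on_def J_def C_def by fast
    show "finite (C m)" for m using A(11) by (auto simp: C_def r_coset_def)
    show "4 * ?d \<le> card (C m)" if "m \<in> J" for m
      unfolding C_def using light_window_choices[OF Ln JG[OF that] light[OF that]] .
    show "?d > 0" by (rule card_block_supp_pos[OF Ln])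
  qed (use Rsym Rdeg in auto)
  define Z where "Z = f ` J"
  have CW: "C m \<subseteq> ?W m" for m by (auto simp: C_def)
  have ZG: "Z \<subseteq> carrier G" using f(1) CW WG by (fastforce simp: Z_def J_def)
  define v where "v = u \<union> (\<Union>z\<in>Z. ?T z)"
  have gv: "good L n v"
    unfolding v_def
  proof (rule good_add_patterns[OF L _ ZG])
    show "good L n u" using u by (simp add: good_def)
    show "z \<notin> ?B <#> supp u" if "z \<in> Z" for z
      using that f(1) by (auto simp: Z_def C_def)
    show "z \<notin> ?B <#> (?P #> z')" if z: "z \<in> Z" "z' \<in> Z" "z \<noteq> z'" for z z'
    proof -
      obtain m m' where "m \<in> J" "m' \<in> J" "z = f m" "z' = f m'" "m \<noteq> m'"
        using z by (auto simp: Z_def)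
      then have "\<not> R z z'" using f(2) by simp
      then show ?thesis using z ZG by (auto simp: R_def)
    qed
  qed simp
  have "saturated (L n) v M"
    unfolding saturated_def
  proof (intro conjI ballI)
    show "M \<subseteq> carrier G" by (rule MG)
    show "disjoint_family_on ?W M" by (rule M(3))
    fix m assume m: "m \<in> M"
    show "\<exists>z\<in>?W m. ?T z \<subseteq> v"
    proof (cases "m \<in> J")
      case True
      then have "f m \<in> ?W m" "?T (f m) \<subseteq> v" using f(1) CW by (auto simp: v_def Z_def)
      then show ?thesis by blast
    next
      case False
      then obtain z where "z \<in> ?W m" "?T z \<subseteq> u" using m by (auto simp: J_def)
      moreover from this have "?T z \<subseteq> v" by (auto simp: v_def)
      ultimately show ?thesis by blast
    qed
  next
    fix g assume g: "g \<in> carrier G"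
    show "\<exists>m\<in>M. ?W g \<inter> ?W m \<noteq> {}"
    proof (cases "heavy (L n) (supp u) g")
      case True
      then show ?thesis using anchoredD(5)[OF M0 g] M(1) by blast
    next
      case False
      then show ?thesis using meet g by (simp add: X_def)
    qed
  qed
  then show ?thesis using that[of v M] gv by (simp add: v_def)
qed

text \<open>
  The levels are settled from the top downwards; what is added later destroys no copy that is
  already present.
\<close>

lemma fill:
  assumes "\<And>j. j < n \<Longrightarrow> admissible L j" and "good L n u"
  shows "\<exists>v. u \<subseteq> v \<and> proper v \<and> (\<forall>j<n. \<exists>M. saturated (L j) v M)"
  using assms
proof (induction n arbitrary: u)
  case 0
  then show ?case using goodD(1) by auto
next
  case (Suc n)
  obtain w M where w: "u \<subseteq> w" "good L n w" "saturated (L n) w M"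
    using fill_level[of n L u] Suc.prems by (metis less_Suc_eq_le)
  have "\<And>j. j < n \<Longrightarrow> admissible L j" using Suc.prems(1) by simp
  then obtain v where v: "w \<subseteq> v" "proper v" "\<forall>j<n. \<exists>M. saturated (L j) v M"
    using Suc.IH w(2) by metis
  have "saturated (L n) v M" using w(3) v(1) by (rule saturated_mono)
  then have "\<forall>j<Suc n. \<exists>M. saturated (L j) v M" using v(3) less_Suc_eq by metis
  then show ?case using v w(1) by (meson subset_trans)
qed

section \<open>Cutting out finite pieces\<close>

text \<open>
  Half of each of the disjoint windows is blocked, while \<open>U\<close> blocks no more than
  \<open>card (block (L j)) * card U\<close> points altogether.
\<close>

lemma card_disjoint_heavy_windows:
  assumes L: "admissible L j" and W: "finite W" "disjoint_family_on (\<lambda>m. win (L j) #> m) W"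
    and U: "finite U" and heavy: "\<And>m. m \<in> W \<Longrightarrow> heavy (L j) U m"
  shows "card W * card (supp (pat (L j))) * 2 ^ (j + 2) \<le> card U"
proof -
  note A = admissibleD[OF L]
  let ?b = "card (block (L j))" and ?p = "card (supp (pat (L j)))"
  let ?X = "\<lambda>m. (win (L j) #> m) \<inter> (block (L j) <#> U)"
  have fin: "finite (block (L j) <#> U)" using finite_block[OF L] U by (rule finite_set_mult)
  have "card W * card (win (L j)) = (\<Sum>m\<in>W. card (win (L j)))" by simp
  also have "\<dots> \<le> (\<Sum>m\<in>W. 2 * card (?X m))"
    using heavy by (intro sum_mono) (simp add: heavy_def)
  also have "\<dots> = 2 * (\<Sum>m\<in>W. card (?X m))" by (simp add: sum_distrib_left)
  also have "(\<Sum>m\<in>W. card (?X m)) = card (\<Union>m\<in>W. ?X m)"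
    using W fin by (intro card_UN_disjoint[symmetric]) (auto simp: disjoint_family_on_def)
  also have "\<dots> \<le> card (block (L j) <#> U)" using fin by (intro card_mono) auto
  also have "\<dots> \<le> ?b * card U" using finite_block[OF L] U by (rule card_set_mult_le)
  finally have 1: "card W * card (win (L j)) \<le> 2 * (?b * card U)" by simp
  have "card W * (2 ^ (j + 3) * (?b * ?p)) \<le> card W * card (win (L j))"
    using A(14) by (rule mult_le_mono2)
  with 1 have "card W * (2 ^ (j + 3) * (?b * ?p)) \<le> 2 * (?b * card U)" by linarith
  moreover have "card W * (2 ^ (j + 3) * (?b * ?p)) = (2 * ?b) * (card W * ?p * 2 ^ (j + 2))"
    by (simp add: power_add)
  moreover have "2 * (?b * card U) = (2 * ?b) * card U" by simp
  moreover have "2 * ?b > 0" using card_block_supp_pos[OF L] by simp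
  ultimately show ?thesis by (metis nat_mult_le_cancel1)
qed

lemma sum_geometric_half: "(\<Sum>j<n. (1 / 2) ^ (j + 2)) = 1 / 2 - (1 / 2 :: real) ^ (n + 1)"
  by (induction n) (auto simp: field_simps)

text \<open>
  The set \<open>U\<close> that makes the windows heavy includes the copies that were added on behalf of these
  windows. The copies of level \<open>j\<close> make up at most a fraction \<open>1 / 2 ^ (j + 2)\<close> of \<open>U\<close>. Therefore at
  most half of \<open>U\<close> consists of copies, and \<open>B\<close> makes up the rest.
\<close>

lemma card_forced_patterns:
  assumes L: "\<And>j. j < n \<Longrightarrow> admissible L j"
    and W: "finite W" "fst ` W \<subseteq> {..<n}"
      "\<And>j. j < n \<Longrightarrow> disjoint_family_on (\<lambda>m. win (L j) #> m) {m. (j, m) \<in> W}"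
    and B: "finite B" and z: "\<And>j m. (j, m) \<in> W \<Longrightarrow> z j m \<in> carrier G"
    and heavy: "\<And>j m. (j, m) \<in> W \<Longrightarrow> heavy (L j) (B \<union> (\<Union>(j, m)\<in>W. supp (pat (L j)) #> z j m)) m"
  shows "card W \<le> card B"
proof -
  define U where "U = B \<union> (\<Union>(j, m)\<in>W. supp (pat (L j)) #> z j m)"
  define w where "w j = card {m. (j, m) \<in> W}" for j
  define p where "p j = card (supp (pat (L j)))" for j
  have jn: "j < n" if "(j, m) \<in> W" for j m using that W(2) by force
  have fin: "finite (supp (pat (L j)) #> x)" if "j < n" for j x
    using admissibleD(1)[OF L[OF that]] by (auto simp: r_coset_def)
  have finU: "finite U" unfolding U_def using B W(1) fin jn by auto
  have finWj: "finite {m. (j, m) \<in> W}" for j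
    by (rule finite_subset[of _ "snd ` W"]) (use W(1) in force)+
  have WS: "W = Sigma {..<n} (\<lambda>j. {m. (j, m) \<in> W})" using jn by auto
  have sumW: "(\<Sum>x\<in>W. f (fst x)) = (\<Sum>j<n. w j * f j)" for f :: "nat \<Rightarrow> nat"
  proof -
    have "(\<Sum>x\<in>W. f (fst x)) = (\<Sum>x\<in>Sigma {..<n} (\<lambda>j. {m. (j, m) \<in> W}). f (fst x))" using WS by simp
    also have "\<dots> = (\<Sum>j<n. \<Sum>m\<in>{m. (j, m) \<in> W}. f j)"
      using finWj by (subst sum.Sigma) (auto simp: case_prod_unfold)
    finally show ?thesis by (simp add: w_def)
  qed
  have bound: "real (w j * p j) \<le> real (card U) * (1 / 2) ^ (j + 2)" if "j < n" for j
  proof -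
    have "w j * p j * 2 ^ (j + 2) \<le> card U"
      unfolding w_def p_def
      using heavy by (intro card_disjoint_heavy_windows L that finWj W(3) finU) (simp add: U_def)
    then have "real (w j * p j) * 2 ^ (j + 2) \<le> real (card U)"
      by (metis of_nat_le_iff of_nat_mult of_nat_numeral of_nat_power)
    then show ?thesis by (simp add: field_simps)
  qed
  have p1: "1 \<le> p j" if "j < n" for j
    using card_block_supp_pos[OF L[OF that]] by (simp add: p_def)
  have "real (\<Sum>j<n. w j * p j) \<le> (\<Sum>j<n. real (card U) * (1 / 2) ^ (j + 2))"
    unfolding of_nat_sum by (intro sum_mono bound) simp
  also have "\<dots> = real (card U) * (1 / 2 - (1 / 2) ^ (n + 1))"
    by (simp only: sum_distrib_left[symmetric] sum_geometric_half)
  also have "\<dots> \<le> real (card U) * (1 / 2)" by (intro mult_left_mono) auto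
  finally have half: "2 * (\<Sum>j<n. w j * p j) \<le> card U" by linarith
  have "card U \<le> card B + card (\<Union>x\<in>W. supp (pat (L (fst x))) #> z (fst x) (snd x))"
    unfolding U_def by (simp add: case_prod_unfold card_Un_le)
  also have "card (\<Union>x\<in>W. supp (pat (L (fst x))) #> z (fst x) (snd x))
      \<le> (\<Sum>x\<in>W. card (supp (pat (L (fst x))) #> z (fst x) (snd x)))"
    using W(1) by (rule card_UN_le)
  also have "\<dots> = (\<Sum>x\<in>W. p (fst x))"
  proof (rule sum.cong[OF refl])
    fix x assume x: "x \<in> W"
    then have "fst x < n" "z (fst x) (snd x) \<in> carrier G" using jn[of "fst x" "snd x"] z[of "fst x" "snd x"] by simp_all
    then show "card (supp (pat (L (fst x))) #> z (fst x) (snd x)) = p (fst x)"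
      unfolding p_def using admissibleD(16)[OF L] by (intro card_r_coset) (auto simp: level_in_group_def)
  qed
  also have "\<dots> = (\<Sum>j<n. w j * p j)" by (rule sumW)
  finally have "card U \<le> card B + (\<Sum>j<n. w j * p j)" by simp
  with half have "(\<Sum>j<n. w j * p j) \<le> card B" by linarith
  moreover have "card W = (\<Sum>j<n. w j)" using sumW[of "\<lambda>_. 1"] by simp
  moreover have "(\<Sum>j<n. w j) \<le> (\<Sum>j<n. w j * p j)"
    using p1 by (intro sum_mono) simp
  ultimately show ?thesis by linarith
qed

text \<open>
  Starting from \<open>B\<close>, the copy in a reserved window is added as soon as the window has become heavy.
  By the bound on their number, there is a largest set \<open>W\<close> of windows treated in this way, and the
  piece \<open>U\<close> consists of \<open>B\<close> and the copies in the windows of \<open>W\<close>. In \<open>U\<close> one reserves the windows of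
  the given families that lie near \<open>U\<close>. The colouring \<open>u\<close> only has to contain the copies that lie
  in \<open>U\<close>, and these have coordinates below \<open>n\<close>.
\<close>

lemma cut:
  assumes L: "\<And>j. j < n \<Longrightarrow> admissible L j" and v: "proper v"
    and M: "\<And>j. j < n \<Longrightarrow> saturated (L j) v (M j)"
    and B: "finite B" "B \<subseteq> carrier G"
  shows "\<exists>U. finite U \<and> B \<subseteq> U \<and> U \<subseteq> carrier G \<and>
    (\<forall>u. proper u \<longrightarrow> supp u = U \<longrightarrow> {(h, i, c). (h, i, c) \<in> v \<and> h \<in> U \<and> i \<le> n} \<subseteq> u \<longrightarrow> good L n u)"
proof -
  have "\<forall>j<n. \<forall>m\<in>M j. \<exists>z\<in>win (L j) #> m. translate (pat (L j)) z \<subseteq> v"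
    using M by (simp add: saturated_def)
  then obtain z where z: "\<And>j m. j < n \<Longrightarrow> m \<in> M j \<Longrightarrow> z j m \<in> win (L j) #> m"
    "\<And>j m. j < n \<Longrightarrow> m \<in> M j \<Longrightarrow> translate (pat (L j)) (z j m) \<subseteq> v" by metis
  have MG: "M j \<subseteq> carrier G" if "j < n" for j using M[OF that] by (simp add: saturated_def)
  have zG: "z j m \<in> carrier G" if "j < n" "m \<in> M j" for j m
    using z(1)[OF that] r_coset_subset_G[OF admissibleD(13)[OF L[OF that(1)]]] MG[OF that(1)] that(2) by blast
  define D where "D W = B \<union> (\<Union>(j, m)\<in>W. supp (pat (L j)) #> z j m)" for W
  define V where "V W \<longleftrightarrow> finite W \<and> W \<subseteq> Sigma {..<n} M \<and> (\<forall>(j, m)\<in>W. heavy (L j) (D W) m)" for W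
  have bound: "card W \<le> card B" if W: "V W" for W
  proof (rule card_forced_patterns[of n L W B z, OF L])
    have sub: "W \<subseteq> Sigma {..<n} M" using W by (simp add: V_def)
    show "finite W" using W by (simp add: V_def)
    show "fst ` W \<subseteq> {..<n}" using sub by auto
    show "disjoint_family_on (\<lambda>m. win (L j) #> m) {m. (j, m) \<in> W}" if "j < n" for j
    proof (rule disjoint_family_on_mono)
      show "{m. (j, m) \<in> W} \<subseteq> M j" using sub by auto
      show "disjoint_family_on (\<lambda>m. win (L j) #> m) (M j)" using M[OF that] by (simp add: saturated_def)
    qed
    show "finite B" by (rule B)
    show "z j m \<in> carrier G" if "(j, m) \<in> W" for j m using that sub zG by auto
    show "heavy (L j) (B \<union> (\<Union>(j, m)\<in>W. supp (pat (L j)) #> z j m)) m" if "(j, m) \<in> W" for j m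
      using that W by (auto simp: V_def D_def)
  qed simp
  have "V {}" by (simp add: V_def)
  then obtain W where W: "V W" and max: "\<And>W'. V W' \<Longrightarrow> card W' \<le> card W"
    using ex_has_greatest_nat[of V "{}" card "card B + 1"] bound by (metis less_Suc_eq_le Suc_eq_plus1)
  have finW: "finite W" and subW: "W \<subseteq> Sigma {..<n} M" using W by (auto simp: V_def)
  have forced: "(j, m) \<in> W" if jm: "j < n" "m \<in> M j" "heavy (L j) (D W) m" for j m
  proof (rule ccontr)
    assume new: "(j, m) \<notin> W"
    have DD: "D W \<subseteq> D (insert (j, m) W)" by (auto simp: D_def)
    have "V (insert (j, m) W)"
      unfolding V_def
    proof (intro conjI ballI)
      show "finite (insert (j, m) W)" using finW by simp
      show "insert (j, m) W \<subseteq> Sigma {..<n} M" using subW jm by simp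
      fix x assume x: "x \<in> insert (j, m) W"
      have "fst x < n" "heavy (L (fst x)) (D W) (snd x)"
        using x jm W subW by (auto simp: V_def)
      then have "heavy (L (fst x)) (D (insert (j, m) W)) (snd x)"
        using heavy_mono[OF _ DD] admissibleD(11)[OF L] by blast
      then show "case x of (j', m') \<Rightarrow> heavy (L j') (D (insert (j, m) W)) m'" by (simp add: case_prod_unfold)
    qed
    then show False using max[of "insert (j, m) W"] new finW by simp
  qed
  show ?thesis
  proof (intro exI[of _ "D W"] conjI allI impI)
    have "finite (supp (pat (L j)) #> x)" if "j < n" for j x
      using admissibleD(1)[OF L[OF that]] by (auto simp: r_coset_def)
    then show "finite (D W)" unfolding D_def using B(1) finW subW by auto
    show "B \<subseteq> D W" by (simp add: D_def)
    have "supp (pat (L j)) #> z j m \<subseteq> carrier G" if jm: "(j, m) \<in> W" for j m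
    proof (rule r_coset_subset_G)
      have "j < n" "m \<in> M j" using jm subW by auto
      then show "z j m \<in> carrier G" "supp (pat (L j)) \<subseteq> carrier G"
        using zG admissibleD(16)[OF L] by (simp_all add: level_in_group_def)
    qed
    then show "D W \<subseteq> carrier G" using B(2) unfolding D_def by (simp add: UN_subset_iff split_beta)
  next
    fix u assume u: "proper u" "supp u = D W" "{(h, i, c). (h, i, c) \<in> v \<and> h \<in> D W \<and> i \<le> n} \<subseteq> u"
    show "good L n u"
      unfolding good_def
    proof (intro conjI allI impI)
      show "proper u" by (rule u)
      fix j assume j: "j < n"
      note Lj = L[OF j] admissibleD[OF L[OF j]]
      note S = M[OF j, unfolded saturated_def]
      define M' where "M' = {m \<in> M j. win (L j) #> m \<subseteq> reach (L j) <#> D W}"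
      have "anchored (L j) u M'"
        unfolding anchored_def u(2)
      proof (intro conjI ballI impI)
        show "M' \<subseteq> carrier G" using MG[OF j] by (auto simp: M'_def)
        show "disjoint_family_on (\<lambda>m. win (L j) #> m) M'"
          by (rule disjoint_family_on_mono[of _ "M j"]) (use S in \<open>auto simp: M'_def\<close>)
        show "win (L j) #> m \<subseteq> reach (L j) <#> D W" if "m \<in> M'" for m using that by (simp add: M'_def)
        show "\<exists>z\<in>win (L j) #> m. translate (pat (L j)) z \<subseteq> u" if m: "m \<in> M'" "heavy (L j) (D W) m" for m
        proof (rule bexI)
          have mM: "m \<in> M j" using m(1) by (simp add: M'_def)
          then show "z j m \<in> win (L j) #> m" using z(1) j by simp
          have W: "(j, m) \<in> W" using forced j mM m(2) by simp
          show "translate (pat (L j)) (z j m) \<subseteq> u"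
          proof
            fix x assume x: "x \<in> translate (pat (L j)) (z j m)"
            obtain h i c where hic: "x = (h, i, c)" by (cases x)
            have "fst x \<in> supp (translate (pat (L j)) (z j m))" using x by (rule imageI)
            moreover have "supp (pat (L j)) #> z j m \<subseteq> D W" 
              unfolding D_def using UN_upper[OF W, of "\<lambda>(j, m). supp (pat (L j)) #> z j m"] by (simp add: le_supI2)
            ultimately have "h \<in> D W" using hic by (auto simp only: supp_translate fst_conv)
            moreover have "i \<le> n" using x[unfolded hic in_translate] Lj(4) j by (metis le_trans less_imp_le)
            moreover have "(h, i, c) \<in> v" using x hic z(2)[OF j mM] by blast
            ultimately show "x \<in> u" using u(3) hic by blast
          qed
        qed
        fix g assume g: "g \<in> carrier G" and hv: "heavy (L j) (D W) g"
        have "\<exists>m\<in>M j. (win (L j) #> g) \<inter> (win (L j) #> m) \<noteq> {}" using S g by simp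
        then obtain m where m: "m \<in> M j" "(win (L j) #> g) \<inter> (win (L j) #> m) \<noteq> {}" by (rule bexE)
        have mG: "m \<in> carrier G" using m(1) MG[OF j] by blast
        have DG: "D W \<subseteq> carrier G" using supp_proper[OF u(1)] u(2) by simp
        have "win (L j) #> m \<subseteq> reach (L j) <#> D W"
          by (rule meeting_window_in_reach[OF Lj(17) DG g mG heavy_meets_block[of L j, OF Lj(1) hv] m(2)])
        then have "m \<in> M'" using m(1) by (simp add: M'_def)
        then show "\<exists>m\<in>M'. (win (L j) #> g) \<inter> (win (L j) #> m) \<noteq> {}" using m(2) by blast
      qed
      then show "\<exists>M. anchored (L j) u M" ..
    qed
  qed
qed

section \<open>The tower of patterns\<close>

text \<open>
  The new colour has to avoid the colours of the two neighbours \<open>\<gamma> i \<otimes> h\<close> and \<open>inv (\<gamma> i) \<otimes> h\<close>, so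
  three colours suffice.
\<close>

lemma proper_insert_colour:
  assumes u: "proper u" and h: "h \<in> carrier G"
  obtains c where "proper (insert (h, i, c) u)"
proof (cases "\<exists>c. (h, i, c) \<in> u")
  case True
  then show ?thesis using u that by (metis insert_absorb)
next
  case False
  note P = properD[OF u]
  have cancel: "k = inv (\<gamma> i) \<otimes> h" if "\<gamma> i \<otimes> k = h" "k \<in> carrier G" for k
    using that by (auto simp: inv_mult_cancel)
  have "\<exists>c<3. \<forall>d. (\<gamma> i \<otimes> h, i, d) \<in> u \<or> (inv (\<gamma> i) \<otimes> h, i, d) \<in> u \<longrightarrow> c \<noteq> d"
  proof -
    have "\<exists>d. \<forall>d'. (k, i, d') \<in> u \<longrightarrow> d' = d" for k using P(3) by (metis (full_types))
    then obtain a b where "\<forall>d. (\<gamma> i \<otimes> h, i, d) \<in> u \<longrightarrow> d = a" "\<forall>d. (inv (\<gamma> i) \<otimes> h, i, d) \<in> u \<longrightarrow> d = b"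
      by metis
    moreover have "\<exists>c<3. c \<noteq> a \<and> c \<noteq> b" for a b :: nat
    proof -
      consider "0 \<noteq> a \<and> 0 \<noteq> b" | "1 \<noteq> a \<and> 1 \<noteq> b" | "2 \<noteq> a \<and> 2 \<noteq> b" by linarith
      then show ?thesis
      proof cases
        case 1 then show ?thesis by (intro exI[of _ 0]) simp
      next
        case 2 then show ?thesis by (intro exI[of _ 1]) simp
      next
        case 3 then show ?thesis by (intro exI[of _ 2]) simp
      qed
    qed
    ultimately show ?thesis by metis
  qed
  then obtain c where c: "c < 3" "\<And>d. (\<gamma> i \<otimes> h, i, d) \<in> u \<Longrightarrow> c \<noteq> d"
    "\<And>d. (inv (\<gamma> i) \<otimes> h, i, d) \<in> u \<Longrightarrow> c \<noteq> d" by metis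
  have "proper (insert (h, i, c) u)"
    unfolding proper_def
  proof (intro conjI allI impI)
    fix k j d assume k: "(k, j, d) \<in> insert (h, i, c) u"
    then show "k \<in> carrier G" "d < 3" using P(1,2) h c(1) by auto
    fix d' assume "(k, j, d') \<in> insert (h, i, c) u"
    then show "d = d'" using k P(3) False by auto
  next
    fix k j d assume k: "(k, j, d) \<in> insert (h, i, c) u" "(\<gamma> j \<otimes> k, j, d) \<in> insert (h, i, c) u"
    consider "(k, j, d) = (h, i, c)" "(\<gamma> j \<otimes> k, j, d) = (h, i, c)" | "(k, j, d) = (h, i, c)" "(\<gamma> j \<otimes> k, j, d) \<in> u"
      | "(k, j, d) \<in> u" "(\<gamma> j \<otimes> k, j, d) = (h, i, c)" | "(k, j, d) \<in> u" "(\<gamma> j \<otimes> k, j, d) \<in> u"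
      using k by blast
    then show "\<gamma> j = \<one>"
    proof cases
      case 1
      then have "\<gamma> i \<otimes> h = h" by simp
      then show ?thesis using 1 h by (simp add: r_cancel_one)
    next
      case 2
      then show ?thesis using c(2) by auto
    next
      case 3
      then have "k = inv (\<gamma> i) \<otimes> h" using cancel P(1) by auto
      then show ?thesis using 3 c(3) by auto
    next
      case 4
      then show ?thesis by (rule P(4))
    qed
  qed
  then show ?thesis by (rule that)
qed

lemma proper_extension:
  assumes "finite D" "D \<subseteq> carrier G \<times> UNIV" "proper u"
  shows "\<exists>v. proper v \<and> u \<subseteq> v \<and> (\<forall>(h, i)\<in>D. \<exists>c. (h, i, c) \<in> v) \<and>
    (\<forall>h i c. (h, i, c) \<in> v \<longrightarrow> (h, i, c) \<in> u \<or> (h, i) \<in> D)"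
  using assms
proof (induction D rule: finite_induct)
  case empty
  then show ?case by (intro exI[of _ u]) auto
next
  case (insert x D)
  obtain h i where x: "x = (h, i)" by (cases x)
  obtain v where v: "proper v" "u \<subseteq> v" "\<forall>(h, i)\<in>D. \<exists>c. (h, i, c) \<in> v" "\<forall>h i c. (h, i, c) \<in> v \<longrightarrow> (h, i, c) \<in> u \<or> (h, i) \<in> D"
    using insert.IH insert.prems by auto
  have "h \<in> carrier G" using insert.prems(1) x by auto
  then obtain c where "proper (insert (h, i, c) v)" by (rule proper_insert_colour[OF v(1)])
  moreover have "u \<subseteq> insert (h, i, c) v" using v(2) by blast
  moreover have "\<forall>(h', i')\<in>insert x D. \<exists>c'. (h', i', c') \<in> insert (h, i, c) v" using v(3) x by auto
  moreover have "\<forall>h' i' c'. (h', i', c') \<in> insert (h, i, c) v \<longrightarrow> (h', i', c') \<in> u \<or> (h', i') \<in> insert x D"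
  proof (intro allI impI)
    fix h' i' c' assume "(h', i', c') \<in> insert (h, i, c) v"
    then show "(h', i', c') \<in> u \<or> (h', i') \<in> insert x D"
      using v(4)[rule_format, of h' i' c'] x by auto
  qed
  ultimately show ?case by blast
qed

text \<open>
  The clauses after the first make the union of the patterns a total colouring.
\<close>

definition tower_level :: "(nat \<Rightarrow> 'a level) \<Rightarrow> nat \<Rightarrow> bool" where
  "tower_level L n \<longleftrightarrow> admissible L n \<and> \<gamma> n \<in> supp (pat (L n)) \<and>
     (\<forall>h\<in>supp (pat (L n)). \<forall>i\<le>n. \<exists>c. (h, i, c) \<in> pat (L n)) \<and>
     (\<forall>m. n = Suc m \<longrightarrow> pat (L m) \<subseteq> pat (L n))"

lemma good_cong:
  assumes "\<And>j. j < n \<Longrightarrow> L j = L' j" shows "good L n u \<longleftrightarrow> good L' n u"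
  using assms by (simp add: good_def)

lemma admissible_cong:
  assumes "\<And>j. j \<le> n \<Longrightarrow> L j = L' j" shows "admissible L n \<longleftrightarrow> admissible L' n"
  using assms good_cong[of n L L'] by (simp add: admissible_def)

lemma tower_level_cong:
  assumes "\<And>j. j \<le> n \<Longrightarrow> L j = L' j" shows "tower_level L n \<longleftrightarrow> tower_level L' n"
  using assms admissible_cong[of n L L'] by (simp add: tower_level_def)

text \<open>
  The windows of a level are so large that its own pattern makes none of them heavy. So the pattern
  is good for one level more, which is what allows the next pattern to extend it.
\<close>

lemma good_previous_pattern:
  assumes L: "admissible L n" shows "good L (Suc n) (pat (L n))"
  unfolding good_def
proof (intro conjI allI impI)
  note A = admissibleD[OF L]
  show "proper (pat (L n))" by (rule A)
  fix j assume "j < Suc n"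
  then consider "j < n" | "j = n" by linarith
  then show "\<exists>M. anchored (L j) (pat (L n)) M"
  proof cases
    case 1
    then show ?thesis using goodD(3)[OF A(2)] by blast
  next
    case 2
    let ?b = "card (block (L n)) * card (supp (pat (L n)))"
    have "\<not> heavy (L n) (supp (pat (L n))) g" for g
    proof -
      let ?Q = "block (L n) <#> supp (pat (L n))"
      have fin: "finite (block (L n))" "finite (supp (pat (L n)))" using finite_block[OF L] A(1) by auto
      have "card ((win (L n) #> g) \<inter> ?Q) \<le> card ?Q"
        using finite_set_mult[OF fin] by (intro card_mono) auto
      also have "\<dots> \<le> ?b" using fin by (rule card_set_mult_le)
      finally have "2 * card ((win (L n) #> g) \<inter> ?Q) \<le> 2 * ?b" by simp
      moreover have "4 * ?b \<le> 2 ^ (n + 3) * ?b"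
      proof (rule mult_le_mono1)
        have "(2::nat) ^ 2 \<le> 2 ^ (n + 3)" by (rule power_increasing) auto
        then show "(4::nat) \<le> 2 ^ (n + 3)" by simp
      qed
      ultimately have "2 * card ((win (L n) #> g) \<inter> ?Q) < card (win (L n))"
        using A(14) card_block_supp_pos[OF L] by linarith
      then show ?thesis by (simp add: heavy_def)
    qed
    then have "anchored (L n) (pat (L n)) {}" by (simp add: anchored_def disjoint_family_on_def)
    then show ?thesis using 2 by blast
  qed
qed

text \<open>
  The new pattern arises by filling up around the previous one, cutting out a finite piece that
  contains \<open>1\<close> and \<open>\<gamma> n\<close>, and colouring its uncoloured points at the coordinates up to \<open>n\<close>. Then \<open>sep\<close>
  is chosen, and last \<open>win\<close>, which has to be large in terms of the other two.
\<close>

lemma extend_tower: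
  assumes L: "\<And>j. j < n \<Longrightarrow> tower_level L j"
  obtains l where "tower_level (L(n := l)) n"
proof -
  have adm: "admissible L j" if "j < n" for j using L[OF that] by (simp add: tower_level_def)
  define u0 where "u0 = (case n of 0 \<Rightarrow> {} | Suc m \<Rightarrow> pat (L m))"
  have u0: "good L n u0" "finite u0"
  proof -
    show "good L n u0"
    proof (cases n)
      case 0
      then show ?thesis by (simp add: u0_def good_def proper_def)
    next
      case (Suc m)
      then show ?thesis using good_previous_pattern adm by (simp add: u0_def)
    qed
    show "finite u0" using adm admissibleD(1) by (cases n) (auto simp: u0_def)
  qed
  have low0: "i \<le> n" if "(h, i, c) \<in> u0" for h i c
  proof (cases n)
    case (Suc m)
    then have "i \<le> m" using that admissibleD(3)[OF adm[of m]] by (simp add: u0_def)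
    then show ?thesis using Suc by simp
  qed (use that in \<open>simp add: u0_def\<close>)
  obtain v where v: "u0 \<subseteq> v" "proper v" "\<forall>j<n. \<exists>M. saturated (L j) v M"
    using fill[OF adm u0(1)] by blast
  then obtain M where M: "\<And>j. j < n \<Longrightarrow> saturated (L j) v (M j)" by metis
  define B where "B = supp u0 \<union> {\<one>, \<gamma> n}"
  have B: "finite B" "B \<subseteq> carrier G" using u0(2) goodD(2)[OF u0(1)] by (auto simp: B_def)
  have "\<exists>U. finite U \<and> B \<subseteq> U \<and> U \<subseteq> carrier G \<and>
    (\<forall>u. proper u \<longrightarrow> supp u = U \<longrightarrow> {(h, i, c). (h, i, c) \<in> v \<and> h \<in> U \<and> i \<le> n} \<subseteq> u \<longrightarrow> good L n u)"
    by (rule cut[OF adm v(2) M B])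
  then obtain U where U: "finite U" "B \<subseteq> U" "U \<subseteq> carrier G" and cutU:
    "\<forall>u. proper u \<longrightarrow> supp u = U \<longrightarrow> {(h, i, c). (h, i, c) \<in> v \<and> h \<in> U \<and> i \<le> n} \<subseteq> u \<longrightarrow> good L n u"
    by (elim exE conjE) (rule that)
  \<comment> \<open>Higher coordinates are dropped; the copies of lower patterns have none.\<close>
  define u1 where "u1 = {(h, i, c). (h, i, c) \<in> v \<and> h \<in> U \<and> i \<le> n}"
  have "u1 \<subseteq> v" by (auto simp: u1_def)
  then have "proper u1" by (rule proper_subset[OF v(2)])
  moreover have "finite (U \<times> {..n})" "U \<times> {..n} \<subseteq> carrier G \<times> UNIV" using U by auto
  ultimately obtain u where u: "proper u" "u1 \<subseteq> u" "\<forall>(h, i)\<in>U \<times> {..n}. \<exists>c. (h, i, c) \<in> u"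
      "\<forall>h i c. (h, i, c) \<in> u \<longrightarrow> (h, i, c) \<in> u1 \<or> (h, i) \<in> U \<times> {..n}"
    by (elim exE[OF proper_extension] conjE) simp
  have dom: "h \<in> U \<and> i \<le> n" if "(h, i, c) \<in> u" for h i c
    using u(4)[rule_format, OF that] by (auto simp: u1_def)
  have supp_u: "supp u = U"
  proof
    show "supp u \<subseteq> U" using dom by auto
    show "U \<subseteq> supp u"
    proof
      fix h assume "h \<in> U"
      then obtain c where "(h, 0, c) \<in> u" using u(3) by blast
      then show "h \<in> supp u" by force
    qed
  qed
  have gu: "good L n u" using cutU[rule_format, OF u(1) supp_u] u(2) by (simp add: u1_def)
  have fin_u: "finite u"
  proof (rule finite_subset)
    show "u \<subseteq> U \<times> {..n} \<times> {..<3}" using dom properD(2)[OF u(1)] by auto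
    show "finite (U \<times> {..n} \<times> {..<3::nat})" using U(1) by simp
  qed
  have u0u: "u0 \<subseteq> u"
  proof
    fix x assume x: "x \<in> u0"
    obtain h i c where hic: "x = (h, i, c)" by (cases x)
    have "h \<in> B" using x hic by (force simp: B_def)
    then have "x \<in> u1" using x hic low0 v(1) U(2) by (auto simp: u1_def)
    then show "x \<in> u" using u(2) by blast
  qed
  define E0 where "E0 = insert \<one> (\<gamma> ` {..n}) \<union> (\<Union>j<n. set_inv (reach (L j)) <#> reach (L j))"
  define E where "E = E0 \<union> set_inv E0"
  have E0: "finite E0" "E0 \<subseteq> carrier G"
  proof -
    have "finite (set_inv (reach (L j)) <#> reach (L j))" if "j < n" for j
      using finite_reach[OF adm[OF that]] by (intro finite_set_mult finite_set_inv)
    then show "finite E0" by (auto simp: E0_def)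
    have "set_inv (reach (L j)) <#> reach (L j) \<subseteq> carrier G" if "j < n" for j
      using reach_closed[OF admissibleD(16)[OF adm[OF that]]] by (intro set_mult_closed set_inv_closed)
    then show "E0 \<subseteq> carrier G" by (auto simp: E0_def)
  qed
  have E: "finite E" "E \<subseteq> carrier G"
    using E0 finite_set_inv set_inv_closed by (auto simp: E_def)
  have Einv: "set_inv E \<subseteq> E"
  proof
    fix x assume "x \<in> set_inv E"
    then obtain y where y: "y \<in> E" "x = inv y" using in_set_inv by auto
    then consider "y \<in> E0" | z where "z \<in> E0" "y = inv z" by (auto simp: E_def in_set_inv)
    then show "x \<in> E"
    proof cases
      case 1
      then show ?thesis using y(2) set_invI by (simp add: E_def)
    next
      case 2
      then have "x = z" using y(2) E0(2) by (auto simp: subset_iff)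
      then show ?thesis using 2 by (simp add: E_def)
    qed
  qed
  \<comment> \<open>The size of \<open>block\<close> does not depend on the windows, so it may be computed before they are chosen.\<close>
  define l0 where "l0 = Level u E {}"
  obtain K where K: "finite K" "K \<subseteq> S n"
      "card K = 2 ^ (n + 3) * (card (block l0) * card (supp u))"
    using infinite_arbitrarily_large[OF S_inf[of n], of "2 ^ (n + 3) * (card (block l0) * card (supp u))"]
    by auto
  define l where "l = Level u E K"
  have bl: "block l = block l0" by (simp add: block_def l_def l0_def)
  have sel: "pat l = u" "sep l = E" "win l = K" by (simp_all add: l_def)
  have "admissible (L(n := l)) n"
    unfolding admissible_def fun_upd_same sel bl
  proof (intro conjI)
    show "finite u" by (rule fin_u)
    show "good (L(n := l)) n u" using gu good_cong[of n "L(n := l)" L u] by simp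
    show "\<forall>(h, i, c)\<in>u. i \<le> n" using dom by auto
    show "\<one> \<in> supp u" using U(2) supp_u by (auto simp: B_def)
    show "finite E" "E \<subseteq> carrier G" "set_inv E \<subseteq> E" by (rule E Einv)+
    show "\<one> \<in> E" "\<gamma> ` {..n} \<subseteq> E" by (auto simp: E_def E0_def)
    show "\<forall>j<n. set_inv (reach ((L(n := l)) j)) <#> reach ((L(n := l)) j) \<subseteq> E"
      by (auto simp: E_def E0_def)
    show "finite K" "K \<subseteq> S n" by (rule K)+
    show "2 ^ (n + 3) * (card (block l0) * card (supp u)) \<le> card K" using K(3) by simp
  qed
  moreover have "\<gamma> n \<in> supp u" using U(2) supp_u by (auto simp: B_def)
  moreover have "\<forall>h\<in>supp u. \<forall>i\<le>n. \<exists>c. (h, i, c) \<in> u" using u(3) unfolding supp_u by auto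
  moreover have "\<forall>m. n = Suc m \<longrightarrow> pat ((L(n := l)) m) \<subseteq> u" using u0u by (auto simp: u0_def)
  ultimately have "tower_level (L(n := l)) n" by (simp add: tower_level_def sel)
  then show ?thesis by (rule that)
qed

lemma tower_exists: "\<exists>L. \<forall>n. tower_level L n"
proof -
  have "\<exists>F. \<forall>n. (\<forall>j<n. tower_level (F n) j) \<and> (\<forall>j<n. F (Suc n) j = F n j)"
  proof (rule dependent_nat_choice)
    show "\<exists>x. \<forall>j<0. tower_level x j" by simp
    fix L n assume L: "\<forall>j<n. tower_level L j"
    then obtain l where l: "tower_level (L(n := l)) n" using extend_tower[of n L] by blast
    have "tower_level (L(n := l)) j" if "j < n" for j
      using L that tower_level_cong[of j "L(n := l)" L] by simp
    then have "\<forall>j<Suc n. tower_level (L(n := l)) j" using l less_Suc_eq by metis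
    then show "\<exists>y. (\<forall>j<Suc n. tower_level y j) \<and> (\<forall>j<n. y j = L j)"
      by (intro exI[of _ "L(n := l)"]) simp
  qed
  then obtain F where F: "\<And>n j. j < n \<Longrightarrow> tower_level (F n) j" "\<And>n j. j < n \<Longrightarrow> F (Suc n) j = F n j"
    by metis
  define L where "L j = F (Suc j) j" for j
  have "F n j = L j" if "j < n" for n j
    using that
  proof (induction n)
    case (Suc n)
    show ?case
    proof (cases "j = n")
      case True
      then show ?thesis by (simp add: L_def)
    next
      case False
      then show ?thesis using Suc F(2) by simp
    qed
  qed simp
  then have "tower_level L n" for n
    using F(1)[of n "Suc n"] tower_level_cong[of n "F (Suc n)" L] by simp
  then show ?thesis by blast
qed

text \<open>
  For \<open>N\<close> large, the window at \<open>g\<close> and all windows that meet it are contained in the support of \<open>p N\<close>,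
  and so they are heavy for it. Therefore one of them is reserved in \<open>p N\<close> and contains a copy of
  \<open>p n\<close> inside \<open>p N\<close>.
\<close>

lemma recurrent_colouring:
  obtains x p where
    "\<And>n. finite (p n)" "\<And>n. p n \<subseteq> p (Suc n)" "x = (\<Union>n. p n)"
    "proper x" "\<And>h i. h \<in> carrier G \<Longrightarrow> \<exists>c. (h, i, c) \<in> x"
    "\<And>n. \<exists>F. finite F \<and> F \<subseteq> S n \<and> (\<forall>g\<in>carrier G. \<exists>s\<in>F. translate (p n) (s \<otimes> g) \<subseteq> x)"
proof -
  obtain L where L: "\<And>n. tower_level L n" using tower_exists by blast
  have adm: "admissible L n" for n using L by (simp add: tower_level_def)
  note A = admissibleD[OF adm]
  define p where "p n = pat (L n)" for n
  define x where "x = (\<Union>n. p n)"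
  have step: "p n \<subseteq> p (Suc n)" for n using L[of "Suc n"] by (simp add: tower_level_def p_def)
  then have mono: "p m \<subseteq> p n" if "m \<le> n" for m n using that by (rule lift_Suc_mono_le)
  have common: "\<exists>n. a \<in> p n \<and> b \<in> p n" if ab: "a \<in> x" "b \<in> x" for a b
  proof -
    obtain k l where "a \<in> p k" "b \<in> p l" using ab by (auto simp: x_def)
    then have "a \<in> p (max k l)" "b \<in> p (max k l)" using mono[of k "max k l"] mono[of l "max k l"] by auto
    then show ?thesis by blast
  qed
  have P: "proper (p n)" for n using A(15) by (simp add: p_def)
  have xproper: "proper x"
    unfolding proper_def
  proof (intro conjI allI impI)
    fix h i c assume h: "(h, i, c) \<in> x"
    then obtain n where "(h, i, c) \<in> p n" by (auto simp: x_def)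
    then show "h \<in> carrier G" "c < 3" using properD(1,2)[OF P] by blast+
    fix c' assume "(h, i, c') \<in> x"
    then obtain n where "(h, i, c) \<in> p n" "(h, i, c') \<in> p n" using common[OF h] by blast
    then show "c = c'" by (rule properD(3)[OF P])
  next
    fix h i c assume "(h, i, c) \<in> x" "(\<gamma> i \<otimes> h, i, c) \<in> x"
    then obtain n where "(h, i, c) \<in> p n" "(\<gamma> i \<otimes> h, i, c) \<in> p n" using common by blast
    then show "\<gamma> i = \<one>" by (rule properD(4)[OF P])
  qed
  have in_supp: "\<gamma> k \<in> supp (p n)" if "k \<le> n" for k n
  proof -
    have "\<gamma> k \<in> supp (p k)" using L[of k] by (simp add: tower_level_def p_def)
    then show ?thesis by (rule subsetD[OF image_mono[OF mono[OF that]]])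
  qed
  have xtotal: "\<exists>c. (h, i, c) \<in> x" if h: "h \<in> carrier G" for h i
  proof -
    obtain k where k: "h = \<gamma> k" using h range_\<gamma> by auto
    define n where "n = max k i"
    have "h \<in> supp (p n)" unfolding k by (rule in_supp) (simp add: n_def)
    moreover have "i \<le> n" by (simp add: n_def)
    ultimately obtain c where "(h, i, c) \<in> p n"
      using L[of n] unfolding tower_level_def p_def by blast
    then show ?thesis by (auto simp: x_def)
  qed
  have recur: "\<exists>F. finite F \<and> F \<subseteq> S n \<and> (\<forall>g\<in>carrier G. \<exists>s\<in>F. translate (p n) (s \<otimes> g) \<subseteq> x)" for n
  proof (intro exI conjI ballI)
    let ?K = "win (L n)"
    let ?F = "?K <#> set_inv ?K <#> ?K"
    show "finite ?F" using A(11) by (intro finite_set_mult finite_set_inv)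
    show "?F \<subseteq> S n"
    proof
      fix y assume "y \<in> ?F"
      then obtain t c where t: "t \<in> ?K <#> set_inv ?K" "c \<in> ?K" "y = t \<otimes> c" by (rule set_multE)
      obtain a i where a: "a \<in> ?K" "i \<in> set_inv ?K" "t = a \<otimes> i" using t(1) by (rule set_multE)
      obtain b where b: "b \<in> ?K" "i = inv b" using a(2) in_set_inv by auto
      show "y \<in> S n" unfolding t(3) a(3) b(2) using A(12) a(1) b(1) t(2) by (intro S_coset) auto
    qed
    fix g assume g: "g \<in> carrier G"
    \<comment> \<open>\<open>T\<close> covers every window that meets the window at \<open>g\<close>.\<close>
    define T where "T = ?K <#> (set_inv ?K <#> (?K #> g))"
    have KG: "?K \<subseteq> carrier G" by (rule A)
    have "finite T" unfolding T_def using A(11) by (intro finite_set_mult finite_set_inv) (auto simp: r_coset_def)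
    moreover have TG: "T \<subseteq> carrier G"
      unfolding T_def using KG g by (intro set_mult_closed set_inv_closed r_coset_subset_G)
    ultimately obtain I where I: "finite I" "T = \<gamma> ` I"
      using range_\<gamma> finite_subset_image[of T \<gamma> UNIV] by auto
    define N where "N = Suc (n + Max (insert 0 I))"
    have kN: "k \<le> N" if "k \<in> I" for k
    proof -
      have "k \<le> Max (insert 0 I)" using I(1) that by (intro Max_ge) auto
      then show ?thesis unfolding N_def by linarith
    qed
    have Tp: "T \<subseteq> supp (p N)" unfolding I(2) by (intro image_subsetI in_supp kN)
    have "n < N" by (simp add: N_def)
    then obtain M where M: "anchored (L n) (p N) M"
      using goodD(3)[OF A(2)[of N]] by (auto simp: p_def)
    have heavyI: "heavy (L n) (supp (p N)) m" if m: "m \<in> carrier G" "?K #> m \<subseteq> T" for m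
    proof -
      have "h \<in> block (L n) <#> supp (p N)" if "h \<in> ?K #> m" for h
      proof -
        have "h \<in> supp (p N)" "h \<in> carrier G" using that m(2) Tp TG by auto
        then have "\<one> \<otimes> h \<in> block (L n) <#> supp (p N)" using one_in_block[OF adm] by (intro set_multI)
        then show ?thesis using \<open>h \<in> carrier G\<close> by simp
      qed
      then have "(?K #> m) \<inter> (block (L n) <#> supp (p N)) = ?K #> m" by blast
      then show ?thesis using card_r_coset[OF KG m(1)] by (simp add: heavy_def)
    qed
    have near: "?K #> m \<subseteq> T" if m: "m \<in> carrier G" "(?K #> g) \<inter> (?K #> m) \<noteq> {}" for m
    proof
      fix y assume "y \<in> ?K #> m"
      then obtain a where a: "a \<in> ?K" "y = a \<otimes> m" by (rule rcosE)
      obtain t where t: "t \<in> ?K #> g" "t \<in> ?K #> m" using m(2) by blast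
      obtain b where b: "b \<in> ?K" "t = b \<otimes> m" using t(2) by (rule rcosE)
      have "b \<in> carrier G" using b(1) KG by blast
      then have "m = inv b \<otimes> t" using b(2) m(1) by (simp add: inv_mult_cancel)
      then show "y \<in> T" unfolding T_def a(2) using a(1) b(1) t(1) by (auto intro!: set_multI set_invI)
    qed
    have "?K #> g \<subseteq> T"
    proof (rule near[OF g])
      show "(?K #> g) \<inter> (?K #> g) \<noteq> {}" using win_nonempty(2)[OF adm] by (auto simp: r_coset_def)
    qed
    then have "heavy (L n) (supp (p N)) g" by (rule heavyI[OF g])
    then obtain m where m: "m \<in> M" "(?K #> g) \<inter> (?K #> m) \<noteq> {}" using anchoredD(5)[OF M g] by blast
    have mG: "m \<in> carrier G" using anchoredD(1)[OF M] m(1) by blast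
    have "heavy (L n) (supp (p N)) m" using near[OF mG m(2)] by (rule heavyI[OF mG])
    then obtain z where z: "z \<in> ?K #> m" "translate (p n) z \<subseteq> p N"
      using anchoredD(4)[OF M m(1)] unfolding p_def by blast
    have "z \<in> T" using near[OF mG m(2)] z(1) by blast
    moreover have "T = ?F #> g"
      unfolding T_def using KG g by (simp add: setmult_rcos_assoc set_mult_assoc set_inv_closed set_mult_closed)
    ultimately obtain s where s: "s \<in> ?F" "z = s \<otimes> g" by (auto elim: rcosE)
    have "translate (p n) (s \<otimes> g) \<subseteq> x" using z(2) s(2) by (auto simp: x_def)
    then show "\<exists>s\<in>?F. translate (p n) (s \<otimes> g) \<subseteq> x" using s(1) by blast
  qed
  show ?thesis
  proof (rule that[of p x])
    show "finite (p n)" for n using A(1) by (simp add: p_def)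
  qed (rule step x_def xproper xtotal recur; assumption?)+
qed

end

section \<open>Flows\<close>

lemma group_actionI:
  fixes G (structure)
  assumes G: "group G"
    and closed: "\<And>g x. g \<in> carrier G \<Longrightarrow> x \<in> X \<Longrightarrow> \<phi> g x \<in> X"
    and ext: "\<And>g. g \<in> carrier G \<Longrightarrow> \<phi> g \<in> extensional X"
    and mult: "\<And>g h x. g \<in> carrier G \<Longrightarrow> h \<in> carrier G \<Longrightarrow> x \<in> X \<Longrightarrow> \<phi> (g \<otimes> h) x = \<phi> g (\<phi> h x)"
    and one: "\<And>x. x \<in> X \<Longrightarrow> \<phi> \<one> x = x"
  shows "group_action G X \<phi>"
proof -
  interpret group G by (rule G)
  have Bij: "\<phi> g \<in> Bij X" if g: "g \<in> carrier G" for g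
  proof -
    have "bij_betw (\<phi> g) X X"
    proof (rule bij_betw_byWitness[where f' = "\<phi> (inv g)"])
      show "\<forall>x\<in>X. \<phi> (inv g) (\<phi> g x) = x"
        using mult[of "inv g" g] g one by simp
      show "\<forall>x\<in>X. \<phi> g (\<phi> (inv g) x) = x"
        using mult[of g "inv g"] g one by simp
      show "\<phi> g ` X \<subseteq> X" using closed g by blast
      have "inv g \<in> carrier G" using g by simp
      then show "\<phi> (inv g) ` X \<subseteq> X" using closed by blast
    qed
    then show ?thesis using ext[OF g] by (simp add: Bij_def)
  qed
  have hom: "\<phi> (g \<otimes> h) = compose X (\<phi> g) (\<phi> h)" if "g \<in> carrier G" "h \<in> carrier G" for g h
  proof (rule extensionalityI[of _ X])
    show "\<phi> (g \<otimes> h) \<in> extensional X" using ext that by simp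
  qed (use mult that in \<open>simp_all add: compose_def\<close>)
  have "\<phi> \<in> hom G (BijGroup X)"
    unfolding hom_def BijGroup_def using Bij hom by (simp add: Pi_iff)
  then show ?thesis
    unfolding group_action_def group_hom_def group_hom_axioms_def
    using G group_BijGroup[of X] by simp
qed

lemma continuous_map_discrete_prod:
  assumes "\<And>a. a \<in> A \<Longrightarrow> continuous_map T T' (f a)"
  shows "continuous_map (prod_topology (discrete_topology A) T) T' (\<lambda>(a, x). f a x)"
  unfolding continuous_map_def
proof (intro conjI allI impI)
  show "(\<lambda>(a, x). f a x) \<in> topspace (prod_topology (discrete_topology A) T) \<rightarrow> topspace T'"
    using assms by (auto simp: continuous_map_def)
  fix U assume U: "openin T' U"
  show "openin (prod_topology (discrete_topology A) T)
    {p \<in> topspace (prod_topology (discrete_topology A) T). (case p of (a, x) \<Rightarrow> f a x) \<in> U}"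
    unfolding openin_prod_topology_alt
  proof (intro allI impI)
    fix a x assume "(a, x) \<in> {p \<in> topspace (prod_topology (discrete_topology A) T). (case p of (a, x) \<Rightarrow> f a x) \<in> U}"
    then have a: "a \<in> A" "x \<in> topspace T" "f a x \<in> U" by auto
    define V where "V = {x \<in> topspace T. f a x \<in> U}"
    have "openin T V" using assms[OF a(1)] U by (simp add: V_def openin_continuous_map_preimage)
    then show "\<exists>W V. openin (discrete_topology A) W \<and> openin T V \<and> a \<in> W \<and> x \<in> V \<and>
       W \<times> V \<subseteq> {p \<in> topspace (prod_topology (discrete_topology A) T). (case p of (a, x) \<Rightarrow> f a x) \<in> U}"
      using a by (intro exI[of _ "{a}"] exI[of _ V]) (auto simp: V_def)
  qed
qed

text \<open>
  The flow of colourings has to be moved to another type of points, and an injection into that type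
  is enough for this.
\<close>

lemma free_flow_transport:
  fixes G (structure) and T :: "'y topology" and f :: "'y \<Rightarrow> 'x"
  assumes G: "group G" and T: "free_flow G T \<phi>" and inj: "inj_on f (topspace T)"
  obtains T' :: "'x topology" and \<phi>' where "free_flow G T' \<phi>'"
    "\<And>D. D \<subseteq> carrier G \<Longrightarrow> minimal_wrt D T \<phi> \<Longrightarrow> minimal_wrt D T' \<phi>'"
proof -
  define X where "X = topspace T"
  define f' where "f' = inv_into X f"
  define T' where "T' = pullback_topology (f ` X) f' T"
  define \<phi>' where "\<phi>' g = restrict (\<lambda>y. f (\<phi> g (f' y))) (f ` X)" for g
  have flow: "flow G T \<phi>" using T by (simp add: free_flow_def)
  interpret A: group_action G X \<phi> using flow by (simp add: flow_def X_def)
  interpret group G by (rule G)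
  have ff': "f' (f x) = x" if "x \<in> X" for x using inj that by (simp add: f'_def X_def)
  have top': "topspace T' = f ` X"
    unfolding T'_def topspace_pullback_topology using ff' by (auto simp: X_def)
  have contf': "continuous_map T' T f'"
    using continuous_map_pullback[OF continuous_map_id, of "f ` X" f' T] by (simp add: T'_def)
  have contf: "continuous_map T T' f"
    unfolding T'_def
  proof (rule continuous_map_pullback')
    show "continuous_map T T (f' \<circ> f)"
      by (rule continuous_map_eq[OF continuous_map_id]) (simp add: ff' X_def)
  qed (auto simp: X_def)
  have maps: "homeomorphic_maps T T' f f'"
    unfolding homeomorphic_maps_def using contf contf' ff' by (auto simp: top' X_def)
  then have homeo: "homeomorphic_map T T' f" by (rule homeomorphic_maps_imp_map)
  then have space: "T homeomorphic_space T'" by (rule homeomorphic_map_imp_homeomorphic_space)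
  have \<phi>X: "\<phi> g x \<in> X" if "g \<in> carrier G" "x \<in> X" for g x using A.element_image that by blast
  have act': "\<phi>' g (f x) = f (\<phi> g x)" if "x \<in> X" for g x using that by (simp add: \<phi>'_def ff')
  have cont: "continuous_map T T (\<phi> g)" if "g \<in> carrier G" for g
  proof -
    have "continuous_map (prod_topology (discrete_topology (carrier G)) T) T (\<lambda>(g, x). \<phi> g x)"
      using flow by (simp add: flow_def)
    moreover have "continuous_map T (prod_topology (discrete_topology (carrier G)) T) (\<lambda>x. (g, x))"
      using that by (simp add: continuous_map_pairwise comp_def)
    ultimately have "continuous_map T T ((\<lambda>(g, x). \<phi> g x) \<circ> (\<lambda>x. (g, x)))"
      by (rule continuous_map_compose[rotated])
    then show ?thesis by (simp add: comp_def)
  qed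
  have "flow G T' \<phi>'"
    unfolding flow_def
  proof (intro conjI)
    show "topspace T' \<noteq> {}" using flow by (simp add: top' flow_def X_def)
    show "compact_space T'" using flow homeomorphic_compact_space[OF space] by (simp add: flow_def)
    show "Hausdorff_space T'" using flow homeomorphic_Hausdorff_space[OF space] by (simp add: flow_def)
    show "group_action G (topspace T') \<phi>'"
      unfolding top'
    proof (rule group_actionI[OF G])
      show "\<phi>' g \<in> extensional (f ` X)" for g by (simp add: \<phi>'_def)
      show "\<phi>' g y \<in> f ` X" if "g \<in> carrier G" "y \<in> f ` X" for g y
        using that \<phi>X by (auto simp: act')
      show "\<phi>' (g \<otimes> h) y = \<phi>' g (\<phi>' h y)" if g: "g \<in> carrier G" "h \<in> carrier G" "y \<in> f ` X" for g h y
      proof -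
        obtain x where x: "x \<in> X" "y = f x" using g(3) by blast
        have "\<phi> (g \<otimes> h) x = \<phi> g (\<phi> h x)" using A.composition_rule[OF x(1) g(1,2)] .
        then show ?thesis using x \<phi>X[OF g(2) x(1)] by (simp add: act')
      qed
      show "\<phi>' \<one> y = y" if y: "y \<in> f ` X" for y
      proof -
        obtain x where x: "x \<in> X" "y = f x" using y by blast
        have "\<phi> \<one> x = x" using A.id_eq_one x(1) by (metis restrict_apply')
        then show ?thesis using x by (simp add: act')
      qed
    qed
    show "continuous_map (prod_topology (discrete_topology (carrier G)) T') T' (\<lambda>(g, x). \<phi>' g x)"
    proof (rule continuous_map_discrete_prod)
      fix g assume g: "g \<in> carrier G"
      have "continuous_map T' T' (f \<circ> (\<phi> g \<circ> f'))"
        using contf cont[OF g] contf' by (intro continuous_map_compose)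
      then show "continuous_map T' T' (\<phi>' g)"
        by (rule continuous_map_eq) (simp add: top' \<phi>'_def)
    qed
  qed
  moreover have "\<phi>' g y \<noteq> y" if y: "y \<in> topspace T'" "g \<in> carrier G" "g \<noteq> \<one>" for g y
  proof -
    obtain x where x: "x \<in> X" "y = f x" using y(1) top' by auto
    have "\<phi> g x \<noteq> x" using T x(1) y by (simp add: free_flow_def X_def)
    then show ?thesis
      using x inj \<phi>X[OF y(2) x(1)] by (simp add: act' inj_on_eq_iff X_def)
  qed
  ultimately have "free_flow G T' \<phi>'" by (simp add: free_flow_def)
  moreover have "minimal_wrt D T' \<phi>'" if D: "D \<subseteq> carrier G" "minimal_wrt D T \<phi>" for D
    unfolding minimal_wrt_def
  proof
    fix y assume "y \<in> topspace T'"
    then obtain x where x: "x \<in> X" "y = f x" using top' by auto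
    have "{\<phi>' s y |s. s \<in> D} = f ` {\<phi> s x |s. s \<in> D}" using x by (auto simp: act')
    moreover have "{\<phi> s x |s. s \<in> D} \<subseteq> topspace T" using D(1) \<phi>X[OF _ x(1)] by (auto simp: X_def)
    ultimately have "T' closure_of {\<phi>' s y |s. s \<in> D} = f ` (T closure_of {\<phi> s x |s. s \<in> D})"
      using homeomorphic_map_closure_of[OF homeo] by simp
    also have "T closure_of {\<phi> s x |s. s \<in> D} = X" using D(2) x(1) by (simp add: minimal_wrt_def X_def)
    finally show "T' closure_of {\<phi>' s y |s. s \<in> D} = topspace T'" by (simp add: top')
  qed
  ultimately show ?thesis using that[of T' \<phi>'] by simp
qed

context windowed_group begin

definition shift :: "'a \<Rightarrow> ('a \<times> nat \<Rightarrow> nat) \<Rightarrow> 'a \<times> nat \<Rightarrow> nat" where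
  "shift g y = restrict (\<lambda>(h, i). y (h \<otimes> g, i)) (carrier G \<times> UNIV)"

definition colourings :: "('a \<times> nat \<Rightarrow> nat) topology" where
  "colourings = product_topology (\<lambda>_. discrete_topology {..<3}) (carrier G \<times> UNIV)"

lemma topspace_colourings: "topspace colourings = (carrier G \<times> UNIV) \<rightarrow>\<^sub>E {..<3}"
  by (simp add: colourings_def)

lemma compact_colourings: "compact_space colourings"
  by (simp add: colourings_def compact_space_product_topology compact_space_discrete_topology)

lemma Hausdorff_colourings: "Hausdorff_space colourings"
  by (simp add: colourings_def Hausdorff_space_product_topology)

lemma shift_apply: "h \<in> carrier G \<Longrightarrow> shift g y (h, i) = y (h \<otimes> g, i)"
  by (simp add: shift_def)

lemma continuous_eval:
  "h \<in> carrier G \<Longrightarrow> continuous_map colourings (discrete_topology {..<3}) (\<lambda>y. y (h, i))"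
  unfolding colourings_def by (rule continuous_map_product_projection) simp

lemma shift_shift:
  assumes "g \<in> carrier G" "h \<in> carrier G" shows "shift g (shift h y) = shift (g \<otimes> h) y"
  using assms by (auto simp: shift_def fun_eq_iff m_assoc)

lemma shift_one: "y \<in> topspace colourings \<Longrightarrow> shift \<one> y = y"
  by (auto simp: shift_def topspace_colourings fun_eq_iff PiE_def extensional_def)

lemma continuous_shift:
  assumes g: "g \<in> carrier G" shows "continuous_map colourings colourings (shift g)"
proof -
  have "continuous_map colourings (discrete_topology {..<3}) (\<lambda>y. shift g y k)"
    if k: "k \<in> carrier G \<times> UNIV" for k
  proof -
    obtain h i where hi: "k = (h, i)" "h \<in> carrier G" using k by auto
    then show ?thesis using continuous_eval[of "h \<otimes> g" i] g by (simp add: shift_apply)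
  qed
  then have "continuous_map colourings (product_topology (\<lambda>_. discrete_topology {..<3}) (carrier G \<times> UNIV)) (shift g)"
    unfolding continuous_map_componentwise by (auto simp: shift_def)
  then show ?thesis by (simp only: colourings_def[symmetric])
qed

lemma shift_in_topspace:
  "g \<in> carrier G \<Longrightarrow> y \<in> topspace colourings \<Longrightarrow> shift g y \<in> topspace colourings"
  using continuous_shift by (simp add: continuous_map_def Pi_iff)

lemma closedin_cylinder:
  assumes "\<And>h i c. (h, i, c) \<in> A \<Longrightarrow> h \<in> carrier G"
  shows "closedin colourings {y \<in> topspace colourings. \<forall>(h, i, c)\<in>A. y (h, i) = c}"
proof -
  define C where "C = (\<lambda>(h, i, c). {y \<in> topspace colourings. y (h, i) = c})"
  have closed: "closedin colourings (C a)" if a: "a \<in> A" for a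
  proof -
    obtain h i c where hic: "a = (h, i, c)" by (cases a)
    then have h: "h \<in> carrier G" using assms a by blast
    have "C a = {y \<in> topspace colourings. y (h, i) \<in> {c} \<inter> {..<3}}"
      using h by (auto simp: C_def hic topspace_colourings PiE_iff)
    also have "closedin colourings \<dots>"
      by (rule closedin_continuous_map_preimage[OF continuous_eval[OF h]]) simp
    finally show ?thesis .
  qed
  have "closedin colourings (\<Inter>(insert (topspace colourings) (C ` A)))"
    using closed by (intro closedin_Inter) auto
  moreover have "\<Inter>(insert (topspace colourings) (C ` A)) =
      {y \<in> topspace colourings. \<forall>(h, i, c)\<in>A. y (h, i) = c}"
    by (auto simp: C_def)
  ultimately show ?thesis by simp
qed

lemma cylinder_neighbourhood:
  assumes V: "openin colourings V" "\<xi> \<in> V"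
  obtains C where "finite C" "C \<subseteq> carrier G \<times> UNIV"
    "\<And>y. y \<in> topspace colourings \<Longrightarrow> (\<And>k. k \<in> C \<Longrightarrow> y k = \<xi> k) \<Longrightarrow> y \<in> V"
proof -
  let ?I = "carrier G \<times> (UNIV :: nat set)"
  obtain U where U: "finite {k \<in> ?I. U k \<noteq> {..<3}}" "\<xi> \<in> PiE ?I U" "PiE ?I U \<subseteq> V"
    using V unfolding colourings_def openin_product_topology_alt by auto
  show ?thesis
  proof (rule that[of "{k \<in> ?I. U k \<noteq> {..<3}}"])
    fix y assume y: "y \<in> topspace colourings"
      and eq: "\<And>k. k \<in> {k \<in> ?I. U k \<noteq> {..<3}} \<Longrightarrow> y k = \<xi> k"
    have "y k \<in> U k" if k: "k \<in> ?I" for k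
    proof (cases "U k = {..<3}")
      case True
      then show ?thesis using PiE_mem[OF y[unfolded topspace_colourings] k] by simp
    next
      case False
      then have "y k = \<xi> k" using eq k by simp
      then show ?thesis using PiE_mem[OF U(2) k] by simp
    qed
    then have "y \<in> PiE ?I U"
      using PiE_arb[OF y[unfolded topspace_colourings]] by (rule PiE_I)
    then show "y \<in> V" using U(3) by blast
  qed (use U(1) in auto)
qed

text \<open>
  Let \<open>\<xi>\<close> be the recurrent colouring and let \<open>V\<close> be an open set that meets the orbit closure, say
  \<open>g \<xi> \<in> V\<close>. Then some pattern \<open>p n\<close> with \<open>S n = inv g <# D\<close> determines a neighbourhood of \<open>\<xi>\<close> that \<open>g\<close>
  maps into \<open>V\<close>. Every point \<open>y\<close> of the orbit closure is moved into this neighbourhood by some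
  \<open>s \<in> S n\<close>, and so \<open>g \<otimes> s\<close>, an element of \<open>D\<close>, moves \<open>y\<close> into \<open>V\<close>.
\<close>

lemma minimal_free_subshift:
  assumes cosets: "\<And>D g N. D \<in> \<D> \<Longrightarrow> g \<in> carrier G \<Longrightarrow> \<exists>n\<ge>N. S n = g <# D"
    and \<D>: "\<And>D. D \<in> \<D> \<Longrightarrow> D \<subseteq> carrier G"
  obtains T :: "('a \<times> nat \<Rightarrow> nat) topology" and \<phi> where
    "topspace T \<subseteq> (carrier G \<times> UNIV) \<rightarrow>\<^sub>E {..<3}" "free_flow G T \<phi>" "\<And>D. D \<in> \<D> \<Longrightarrow> minimal_wrt D T \<phi>"
proof -
  obtain x p where p: "\<And>n. finite (p n)" "\<And>n. p n \<subseteq> p (Suc n)" "x = (\<Union>n. p n)"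
    and x: "proper x" "\<And>h i. h \<in> carrier G \<Longrightarrow> \<exists>c. (h, i, c) \<in> x"
    and recur: "\<And>n. \<exists>F. finite F \<and> F \<subseteq> S n \<and> (\<forall>g\<in>carrier G. \<exists>s\<in>F. translate (p n) (s \<otimes> g) \<subseteq> x)"
    by (rule recurrent_colouring) blast
  let ?I = "carrier G \<times> (UNIV :: nat set)"
  have pmono: "p m \<subseteq> p n" if "m \<le> n" for m n using p(2) that by (rule lift_Suc_mono_le)
  define \<xi> where "\<xi> = restrict (\<lambda>(h, i). THE c. (h, i, c) \<in> x) ?I"
  have \<xi>: "\<xi> (h, i) = c \<longleftrightarrow> (h, i, c) \<in> x" if h: "h \<in> carrier G" for h i c
  proof -
    have "\<exists>!c. (h, i, c) \<in> x" using x(2)[OF h] properD(3)[OF x(1)] by blast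
    then have "(h, i, THE c. (h, i, c) \<in> x) \<in> x" by (rule theI')
    then show ?thesis using h properD(3)[OF x(1)] by (auto simp: \<xi>_def)
  qed
  have \<xi>_top: "\<xi> \<in> topspace colourings"
  proof -
    have "\<xi> (h, i) < 3" if "h \<in> carrier G" for h i
      using \<xi>[OF that, of i "\<xi> (h, i)"] properD(2)[OF x(1)] by blast
    then show ?thesis by (auto simp: topspace_colourings PiE_iff) (simp add: \<xi>_def)
  qed
  define Orb where "Orb = {shift g \<xi> |g. g \<in> carrier G}"
  have Orb_top: "Orb \<subseteq> topspace colourings" using shift_in_topspace \<xi>_top by (auto simp: Orb_def)
  define X where "X = colourings closure_of Orb"
  define T where "T = subtopology colourings X"
  define \<phi> where "\<phi> g = restrict (shift g) X" for g
  have X_top: "X \<subseteq> topspace colourings" by (simp add: X_def closure_of_subset_topspace)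
  have X_least: "X \<subseteq> C" if "closedin colourings C" "\<And>g. g \<in> carrier G \<Longrightarrow> shift g \<xi> \<in> C" for C
    unfolding X_def using that by (intro closure_of_minimal) (auto simp: Orb_def)
  have OrbX: "Orb \<subseteq> X" unfolding X_def using Orb_top by (rule closure_of_subset)
  have topT: "topspace T = X" using X_top by (auto simp: T_def)
  have shiftX: "shift g y \<in> X" if g: "g \<in> carrier G" "y \<in> X" for g y
  proof -
    have "shift g ` Orb \<subseteq> Orb"
    proof
      fix z assume "z \<in> shift g ` Orb"
      then obtain k where k: "k \<in> carrier G" "z = shift g (shift k \<xi>)" by (auto simp: Orb_def)
      then have "z = shift (g \<otimes> k) \<xi>" using g(1) by (simp add: shift_shift)
      then show "z \<in> Orb" using g(1) k(1) by (auto simp: Orb_def)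
    qed
    then have "colourings closure_of (shift g ` Orb) \<subseteq> X" unfolding X_def by (rule closure_of_mono)
    moreover have "shift g ` X \<subseteq> colourings closure_of (shift g ` Orb)"
      unfolding X_def by (rule continuous_map_image_closure_subset[OF continuous_shift[OF g(1)]])
    ultimately show ?thesis using g(2) by blast
  qed
  have "flow G T \<phi>"
    unfolding flow_def
  proof (intro conjI)
    show "topspace T \<noteq> {}" using OrbX one_closed by (auto simp: topT Orb_def)
    show "compact_space T"
      unfolding T_def using closedin_compact_space[OF compact_colourings, of X]
      by (simp add: X_def compact_space_subtopology)
    show "Hausdorff_space T" unfolding T_def by (rule Hausdorff_space_subtopology[OF Hausdorff_colourings])
    show "group_action G (topspace T) \<phi>"
      unfolding topT
    proof (rule group_actionI[OF is_group])
      show "\<phi> g \<in> extensional X" for g by (simp add: \<phi>_def)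
      show "\<phi> g y \<in> X" if "g \<in> carrier G" "y \<in> X" for g y using that shiftX by (simp add: \<phi>_def)
      show "\<phi> (g \<otimes> h) y = \<phi> g (\<phi> h y)" if "g \<in> carrier G" "h \<in> carrier G" "y \<in> X" for g h y
        using that shiftX by (simp add: \<phi>_def shift_shift)
      show "\<phi> \<one> y = y" if "y \<in> X" for y
        using shift_one[of y] that X_top by (auto simp: \<phi>_def)
    qed
    show "continuous_map (prod_topology (discrete_topology (carrier G)) T) T (\<lambda>(g, x). \<phi> g x)"
    proof (rule continuous_map_discrete_prod)
      fix g assume g: "g \<in> carrier G"
      have "continuous_map T T (shift g)"
        unfolding T_def continuous_map_in_subtopology
        using continuous_map_from_subtopology[OF continuous_shift[OF g], of X] shiftX[OF g] X_top by auto
      then show "continuous_map T T (\<phi> g)"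
        by (rule continuous_map_eq) (simp add: topT \<phi>_def)
    qed
  qed
  moreover have "\<phi> g y \<noteq> y" if y: "y \<in> topspace T" "g \<in> carrier G" "g \<noteq> \<one>" for g y
  proof -
    obtain i where i: "g = \<gamma> i" using y(2) range_\<gamma> by auto
    let ?A = "{(c, d). c < 3 \<and> d < 3 \<and> c \<noteq> (d :: nat)}"
    have "continuous_map colourings (discrete_topology ({..<3} \<times> {..<3})) (\<lambda>y. (y (\<one>, i), y (g, i)))"
      unfolding prod_topology_discrete_topology using y(2)
      by (intro continuous_map_pairedI continuous_eval) simp_all
    then have "closedin colourings {y \<in> topspace colourings. (y (\<one>, i), y (g, i)) \<in> ?A}"
      by (rule closedin_continuous_map_preimage) auto
    then have "X \<subseteq> {y \<in> topspace colourings. (y (\<one>, i), y (g, i)) \<in> ?A}"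
    proof (rule X_least)
      fix k assume k: "k \<in> carrier G"
      have top: "shift k \<xi> \<in> topspace colourings" using shift_in_topspace[OF k \<xi>_top] .
      then have "shift k \<xi> (\<one>, i) < 3" "shift k \<xi> (g, i) < 3"
        using y(2) by (auto simp: topspace_colourings PiE_iff)
      moreover have "\<xi> (k, i) \<noteq> \<xi> (g \<otimes> k, i)"
      proof
        assume eq: "\<xi> (k, i) = \<xi> (g \<otimes> k, i)"
        have "(k, i, \<xi> (k, i)) \<in> x" "(g \<otimes> k, i, \<xi> (k, i)) \<in> x"
          using \<xi>[OF k, of i "\<xi> (k, i)"] \<xi>[of "g \<otimes> k" i "\<xi> (k, i)"] y(2) k eq by simp_all
        then show False using properD(4)[OF x(1)] y(3) i by blast
      qed
      ultimately show "shift k \<xi> \<in> {y \<in> topspace colourings. (y (\<one>, i), y (g, i)) \<in> ?A}"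
        using top y(2) k by (simp add: shift_apply)
    qed
    then have "y (\<one>, i) \<noteq> y (g, i)" using y(1) topT by auto
    moreover have "\<phi> g y (\<one>, i) = y (g, i)" using y topT by (simp add: \<phi>_def shift_apply)
    ultimately show ?thesis by auto
  qed
  ultimately have free: "free_flow G T \<phi>" by (simp add: free_flow_def)
  have "minimal_wrt D T \<phi>" if D: "D \<in> \<D>" for D
    unfolding minimal_wrt_def
  proof
    fix y assume "y \<in> topspace T"
    then have yX: "y \<in> X" using topT by simp
    have "z \<in> T closure_of {\<phi> s y |s. s \<in> D}" if zX: "z \<in> X" for z
      unfolding in_closure_of
    proof (intro conjI allI impI)
      show "z \<in> topspace T" using zX topT by simp
      fix W assume W: "z \<in> W \<and> openin T W"
      then obtain V where V: "openin colourings V" "W = V \<inter> X" unfolding T_def openin_subtopology by auto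
      then obtain g where g: "g \<in> carrier G" "shift g \<xi> \<in> V"
        using zX W unfolding X_def in_closure_of Orb_def by blast
      define V' where "V' = {y \<in> topspace colourings. shift g y \<in> V}"
      have "openin colourings V'"
        unfolding V'_def using continuous_shift[OF g(1)] V(1) by (rule openin_continuous_map_preimage)
      moreover have "\<xi> \<in> V'" using g(2) \<xi>_top by (simp add: V'_def)
      ultimately obtain C where C: "finite C" "C \<subseteq> ?I"
        "\<And>y. y \<in> topspace colourings \<Longrightarrow> (\<And>k. k \<in> C \<Longrightarrow> y k = \<xi> k) \<Longrightarrow> y \<in> V'"
        by (rule cylinder_neighbourhood) blast
      have "\<exists>N. \<forall>k\<in>C. (fst k, snd k, \<xi> k) \<in> p N"
        using C(1,2)
      proof (induction C rule: finite_induct)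
        case (insert k C)
        then obtain N where N: "\<forall>k\<in>C. (fst k, snd k, \<xi> k) \<in> p N" by auto
        have "(fst k, snd k, \<xi> k) \<in> x" using \<xi>[of "fst k" "snd k" "\<xi> k"] insert.prems by auto
        then obtain M where M: "(fst k, snd k, \<xi> k) \<in> p M" using p(3) by auto
        have "\<forall>k'\<in>insert k C. (fst k', snd k', \<xi> k') \<in> p (max M N)"
          using M N pmono[of M "max M N"] pmono[of N "max M N"] by auto
        then show ?case ..
      qed simp
      then obtain N where N: "\<forall>k\<in>C. (fst k, snd k, \<xi> k) \<in> p N" ..
      \<comment> \<open>A later pattern is used, one that recurs along the coset of \<open>D\<close> that \<open>g\<close> moves back to \<open>D\<close>.\<close>
      obtain n where n: "N \<le> n" "S n = inv g <# D" using cosets[OF D, of "inv g" N] g(1) by auto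
      obtain F where F: "finite F" "F \<subseteq> S n" "\<forall>k\<in>carrier G. \<exists>s\<in>F. translate (p n) (s \<otimes> k) \<subseteq> x"
        using recur[of n] by (elim exE conjE)
      have FG: "s \<in> carrier G" if "s \<in> F" for s by (rule subsetD[OF S_sub subsetD[OF F(2) that]])
      have pG: "h \<in> carrier G" if "(h, i, c) \<in> p n" for h i c
      proof -
        have "(h, i, c) \<in> x" unfolding p(3) using that by (rule UN_I[OF UNIV_I])
        then show ?thesis by (rule properD(1)[OF x(1)])
      qed
      define Cy where "Cy s = {y \<in> topspace colourings. \<forall>(h, i, c)\<in>translate (p n) s. y (h, i) = c}" for s
      have closed: "closedin colourings (Cy s)" if "s \<in> F" for s
        unfolding Cy_def by (rule closedin_cylinder) (use pG FG[OF that] in \<open>auto simp: in_translate\<close>)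
      \<comment> \<open>The recurrence of the pattern passes from the orbit to its closure because \<open>F\<close> is finite.\<close>
      have "X \<subseteq> (\<Union>s\<in>F. Cy s)"
      proof (rule X_least)
        show "closedin colourings (\<Union>s\<in>F. Cy s)" using F(1) closed by (intro closedin_Union) auto
        fix k assume k: "k \<in> carrier G"
        obtain s where s: "s \<in> F" "translate (p n) (s \<otimes> k) \<subseteq> x" using F(3) k by blast
        have "shift k \<xi> (h, i) = c" if hic: "(h, i, c) \<in> translate (p n) s" for h i c
        proof -
          obtain b where b: "(b, i, c) \<in> p n" "h = b \<otimes> s" using hic unfolding in_translate by blast
          have cl: "b \<in> carrier G" "s \<in> carrier G" using pG[OF b(1)] FG[OF s(1)] .
          have "(b \<otimes> (s \<otimes> k), i, c) \<in> translate (p n) (s \<otimes> k)"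
            unfolding in_translate using b(1) by blast
          then have "(b \<otimes> (s \<otimes> k), i, c) \<in> x" by (rule subsetD[OF s(2)])
          then have "\<xi> (h \<otimes> k, i) = c" using \<xi>[of "h \<otimes> k" i c] b(2) cl k by (simp add: m_assoc)
          then show ?thesis using b(2) cl by (simp add: shift_apply)
        qed
        then show "shift k \<xi> \<in> (\<Union>s\<in>F. Cy s)"
          using s(1) shift_in_topspace[OF k \<xi>_top] by (auto simp: Cy_def)
      qed
      then obtain s where s: "s \<in> F" "y \<in> Cy s" using yX by blast
      obtain d where d: "d \<in> D" "s = inv g \<otimes> d" using s(1) F(2) n(2) by (auto simp: l_coset_def)
      have dG: "d \<in> carrier G" using d(1) \<D>[OF D] by blast
      have y_top: "y \<in> topspace colourings" using yX X_top by blast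
      have "shift s y \<in> V'"
      proof (rule C(3))
        show "shift s y \<in> topspace colourings" using shift_in_topspace[OF FG[OF s(1)] y_top] .
        fix k assume k: "k \<in> C"
        obtain h i where hi: "k = (h, i)" by (cases k)
        have h: "h \<in> carrier G" using k C(2) hi by auto
        have "(h, i, \<xi> k) \<in> p n" using N k hi pmono[OF n(1)] by auto
        then have "(h \<otimes> s, i, \<xi> k) \<in> translate (p n) s" unfolding in_translate by blast
        then have "y (h \<otimes> s, i) = \<xi> k" using s(2) by (auto simp: Cy_def)
        then show "shift s y k = \<xi> k" using h by (simp add: hi shift_apply)
      qed
      then have "shift (g \<otimes> s) y \<in> V" using g(1) FG[OF s(1)] by (simp add: V'_def shift_shift)
      moreover have "g \<otimes> s = d" using d(2) g(1) dG by (simp add: m_assoc[symmetric])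
      ultimately have "\<phi> d y \<in> W" using V(2) yX shiftX[OF dG yX] by (simp add: \<phi>_def)
      then show "\<exists>w. w \<in> {\<phi> s y |s. s \<in> D} \<and> w \<in> W" using d(1) by blast
    qed
    then have "X \<subseteq> T closure_of {\<phi> s y |s. s \<in> D}" by blast
    then show "T closure_of {\<phi> s y |s. s \<in> D} = topspace T"
      using closure_of_subset_topspace[of T] topT by blast
  qed
  moreover have "topspace T \<subseteq> (carrier G \<times> UNIV) \<rightarrow>\<^sub>E {..<3}" using topT X_top by (simp add: topspace_colourings)
  ultimately show ?thesis using that[of T \<phi>] free by simp
qed

end

section \<open>Minimality with respect to all subgroups that are not locally finite\<close>

lemma (in group) coset_of_subgroup_closed:
  assumes D: "subgroup D G" and h: "h \<in> carrier G"
    and abc: "a \<in> h <# D" "b \<in> h <# D" "c \<in> h <# D"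
  shows "a \<otimes> inv b \<otimes> c \<in> h <# D"
proof -
  interpret D: subgroup D G by (rule D)
  obtain x y z where xyz: "x \<in> D" "y \<in> D" "z \<in> D" "a = h \<otimes> x" "b = h \<otimes> y" "c = h \<otimes> z"
    using abc by (auto simp: l_coset_def)
  have cl: "x \<in> carrier G" "y \<in> carrier G" "z \<in> carrier G" using xyz(1-3) D.mem_carrier by blast+
  have "a \<otimes> inv b \<otimes> c = h \<otimes> (x \<otimes> inv y \<otimes> z)"
    using cl h xyz(4-6) by (simp add: inv_mult_group m_assoc inv_mult_cancel)
  then show ?thesis using xyz(1-3) by (auto simp: l_coset_def)
qed

lemma (in group) infinite_l_coset:
  assumes "D \<subseteq> carrier G" "h \<in> carrier G" "infinite D" shows "infinite (h <# D)"
proof -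
  have "h <# D = (\<lambda>d. h \<otimes> d) ` D" by (auto simp: l_coset_def)
  moreover have "inj_on (\<lambda>d. h \<otimes> d) D" 
    by (rule inj_on_inverseI[where g = "\<lambda>y. inv h \<otimes> y"]) (use assms in \<open>auto simp: inv_mult_cancel\<close>)
  ultimately show ?thesis using assms(3) by (simp add: finite_image_iff)
qed

text \<open>
  Since \<open>A\<close> is countably infinite, triples \<open>(h, i, c)\<close> can be coded by elements of \<open>A\<close>, and a colouring
  by the set of the codes of its graph. The singleton only adjusts the type.
\<close>

lemma inj_on_colouring_code:
  assumes A: "countable A" "infinite A"
  shows "\<exists>f :: ('g \<times> nat \<Rightarrow> nat) \<Rightarrow> 'g set set. inj_on f ((A \<times> UNIV) \<rightarrow>\<^sub>E {..<3})"
proof -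
  let ?B = "A \<times> (UNIV :: nat set) \<times> (UNIV :: nat set)"
  have cB: "countable ?B" using A(1) by (intro countable_SIGMA) auto
  define e where "e = from_nat_into A \<circ> to_nat_on ?B"
  have "inj_on e ?B"
    unfolding e_def
  proof (rule comp_inj_on)
    show "inj_on (to_nat_on ?B) ?B" using cB by (rule inj_on_to_nat_on)
    have "inj (from_nat_into A)" using bij_betw_from_nat_into[OF A] by (simp add: bij_betw_def)
    then show "inj_on (from_nat_into A) (to_nat_on ?B ` ?B)" by (rule inj_on_subset) simp
  qed
  define gr where "gr y = {(h, i, c). h \<in> A \<and> y (h, i) = c}" for y :: "'g \<times> nat \<Rightarrow> nat"
  have "inj_on (\<lambda>y. {e ` gr y}) ((A \<times> UNIV) \<rightarrow>\<^sub>E {..<3})"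
  proof (rule inj_onI)
    fix y z assume y: "y \<in> (A \<times> UNIV) \<rightarrow>\<^sub>E {..<3}" and z: "z \<in> (A \<times> UNIV) \<rightarrow>\<^sub>E {..<3}"
      and "{e ` gr y} = {e ` gr z}"
    then have "e ` gr y = e ` gr z" by simp
    moreover have "gr y \<subseteq> ?B" "gr z \<subseteq> ?B" by (auto simp: gr_def)
    ultimately have eq: "gr y = gr z" using inj_on_image_eq_iff[OF \<open>inj_on e ?B\<close>] by blast
    show "y = z"
    proof (rule PiE_ext[OF y z])
      fix k assume "k \<in> A \<times> (UNIV :: nat set)"
      then obtain h i where hi: "k = (h, i)" "h \<in> A" by auto
      then have "(h, i, y k) \<in> gr y" by (simp add: gr_def)
      then have "(h, i, y k) \<in> gr z" unfolding eq .
      then show "y k = z k" by (simp add: gr_def hi)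
    qed
  qed
  then show ?thesis by blast
qed

theorem corollary1p4:
  fixes G :: "('g, 'm) monoid_scheme"
  assumes "group G" and "countable (carrier G)" and "infinite (carrier G)"
  shows "\<exists>(T :: 'g flow_point topology) (\<phi> :: 'g \<Rightarrow> 'g flow_point \<Rightarrow> 'g flow_point).
           free_flow G T \<phi> \<and>
           (\<forall>D. subgroup D G \<and> \<not> locally_finite_group (G\<lparr>carrier := D\<rparr>) \<longrightarrow> minimal_wrt D T \<phi>)"
proof -
  interpret group G by (rule assms)
  \<comment> \<open>With the whole group included, \<open>\<D>\<close> is nonempty even if \<open>G\<close> is locally finite.\<close>
  define \<D> where "\<D> = insert (carrier G) {D \<in> generate G ` {A. finite A \<and> A \<subseteq> carrier G}. infinite D}"
  have \<D>: "subgroup D G \<and> infinite D" if "D \<in> \<D>" for D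
    using that generate_is_subgroup subgroup_self assms(3) by (auto simp: \<D>_def)
  have \<D>_sub: "D \<subseteq> carrier G" if "D \<in> \<D>" for D using \<D>[OF that] subgroup.subset by blast
  have "countable (generate G ` {A. finite A \<and> A \<subseteq> carrier G})"
    by (intro countable_image countable_Collect_finite_subset assms)
  then have "countable \<D>" unfolding \<D>_def by (intro countable_insert) (rule countable_subset[rotated], auto)
  define \<S> where "\<S> = (\<lambda>(h, D). h <#\<^bsub>G\<^esub> D) ` (carrier G \<times> \<D>)"
  have "countable \<S>" unfolding \<S>_def using assms(2) \<open>countable \<D>\<close> by (intro countable_image countable_SIGMA)
  moreover have "\<S> \<noteq> {}" using one_closed by (auto simp: \<S>_def \<D>_def)
  ultimately have range\<S>: "range (from_nat_into \<S>) = \<S>" by (intro range_from_nat_into)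
  \<comment> \<open>Decoding pairs lets every coset occur infinitely often.\<close>
  define S where "S n = from_nat_into \<S> (fst (prod_decode n))" for n
  have S: "\<exists>h D. h \<in> carrier G \<and> D \<in> \<D> \<and> S n = h <#\<^bsub>G\<^esub> D" for n
  proof -
    have "S n \<in> \<S>" unfolding S_def using range\<S> by blast
    then show ?thesis by (auto simp: \<S>_def)
  qed
  define \<gamma> where "\<gamma> = from_nat_into (carrier G)"
  interpret W: windowed_group G \<gamma> S
  proof
    show "range \<gamma> = carrier G"
      unfolding \<gamma>_def using assms(2) one_closed by (intro range_from_nat_into) auto
  next
    fix n
    obtain h D where hD: "h \<in> carrier G" "D \<in> \<D>" "S n = h <#\<^bsub>G\<^esub> D" using S by blast
    show "S n \<subseteq> carrier G" unfolding hD(3) using \<D>_sub[OF hD(2)] hD(1) by (rule l_coset_subset_G)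
    show "infinite (S n)"
      unfolding hD(3) using \<D>_sub[OF hD(2)] hD(1) \<D>[OF hD(2)] by (intro infinite_l_coset) simp_all
    fix a b c assume "a \<in> S n" "b \<in> S n" "c \<in> S n"
    then show "a \<otimes>\<^bsub>G\<^esub> inv\<^bsub>G\<^esub> b \<otimes>\<^bsub>G\<^esub> c \<in> S n"
      unfolding hD(3) using \<D>[OF hD(2)] hD(1) by (intro coset_of_subgroup_closed) simp_all
  qed
  have cosets: "\<exists>n\<ge>N. S n = g <#\<^bsub>G\<^esub> D" if gD: "D \<in> \<D>" "g \<in> carrier G" for D g N
  proof -
    have "g <#\<^bsub>G\<^esub> D \<in> range (from_nat_into \<S>)" unfolding range\<S> using gD by (auto simp: \<S>_def)
    then obtain k where k: "from_nat_into \<S> k = g <#\<^bsub>G\<^esub> D" by auto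
    have "N \<le> prod_encode (k, N)" by (rule le_prod_encode_2)
    moreover have "S (prod_encode (k, N)) = g <#\<^bsub>G\<^esub> D" using k by (simp add: S_def)
    ultimately show ?thesis by blast
  qed
  obtain T :: "('g \<times> nat \<Rightarrow> nat) topology" and \<phi> where T:
    "topspace T \<subseteq> (carrier G \<times> UNIV) \<rightarrow>\<^sub>E {..<3}" "free_flow G T \<phi>" "\<And>D. D \<in> \<D> \<Longrightarrow> minimal_wrt D T \<phi>"
    using W.minimal_free_subshift[OF cosets \<D>_sub] by blast
  obtain f :: "('g \<times> nat \<Rightarrow> nat) \<Rightarrow> 'g set set" where "inj_on f ((carrier G \<times> UNIV) \<rightarrow>\<^sub>E {..<3})"
    using inj_on_colouring_code[OF assms(2,3)] by blast
  then have "inj_on f (topspace T)" using T(1) by (rule inj_on_subset)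
  then obtain T' :: "'g flow_point topology" and \<phi>' where T': "free_flow G T' \<phi>'"
    "\<And>D. D \<subseteq> carrier G \<Longrightarrow> minimal_wrt D T \<phi> \<Longrightarrow> minimal_wrt D T' \<phi>'"
    using free_flow_transport[OF assms(1) T(2)] by blast
  have "minimal_wrt D T' \<phi>'" if D: "subgroup D G" "\<not> locally_finite_group (G\<lparr>carrier := D\<rparr>)" for D
  proof -
    have "\<exists>A. finite A \<and> A \<subseteq> D \<and> infinite (generate (G\<lparr>carrier := D\<rparr>) A)"
      using D(2) unfolding locally_finite_group_def by simp
    then obtain A where A: "finite A" "A \<subseteq> D" "infinite (generate (G\<lparr>carrier := D\<rparr>) A)"
      by (elim exE conjE)
    have DG: "D \<subseteq> carrier G" using D(1) by (rule subgroup.subset)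
    have "infinite (generate G A)" using A(3) unfolding generate_consistent[OF A(2) D(1)] .
    moreover have "generate G A \<in> generate G ` {A. finite A \<and> A \<subseteq> carrier G}"
      using A(1) subset_trans[OF A(2) DG] by (intro imageI) simp
    ultimately have "generate G A \<in> \<D>" by (simp add: \<D>_def)
    then have min: "minimal_wrt (generate G A) T' \<phi>'" by (intro T'(2) T(3) \<D>_sub)
    have sub: "generate G A \<subseteq> D" using A(2) D(1) by (rule generate_subgroup_incl)
    show ?thesis
      unfolding minimal_wrt_def
    proof
      fix x assume x: "x \<in> topspace T'"
      have "T' closure_of {\<phi>' s x |s. s \<in> generate G A} \<subseteq> T' closure_of {\<phi>' s x |s. s \<in> D}"
        using sub by (intro closure_of_mono) blast
      then have "topspace T' \<subseteq> T' closure_of {\<phi>' s x |s. s \<in> D}"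
        using min x by (simp add: minimal_wrt_def)
      then show "T' closure_of {\<phi>' s x |s. s \<in> D} = topspace T'"
        by (rule subset_antisym[OF closure_of_subset_topspace])
    qed
  qed
  then show ?thesis using T'(1) by blast
qed

end
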